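(* Let $f\in\mathcal{S}_\kappa$ be defined on $\mathbb{D}\setminus\Lambda$ with $\Lambda$ discrete, and let $\tilde f$ be its (unique) extension to a standard function, which has $q$ poles (counted with multiplicity) and some jumps, all jumps lying in $\mathbb{D}\setminus\Lambda$. Then for every nonempty open set $\Omega\subseteq\mathbb{D}\setminus\Lambda$ there exists a positive integer $n$ such that $$\mathbf{k}_n(f;\Omega)=q+\ell_\Omega,$$ where $\ell_\Omega$ is the number of jumps of $\tilde f$ belonging to $\Omega$ and $\mathbf{k}_n(f;\Omega)=\max_{z_1,\dots,z_n\in\Omega\ \text{distinct}}\mathrm{sq}_-P_n(f;z_1,\dots,z_n)$.
   Context: $\mathbb{D}$ is the open unit disk; a set $\Lambda\subset\mathbb{D}$ is discrete if at most countable with accumulation points only on the unit circle. A Schur function is an analytic $S:\mathbb{D}\to\mathbb{C}$ with $|S|\le1$; a Blaschke product is a rational function analytic on $\mathbb{D}$ and unimodular on the unit circle, its degree being its number of zeros in $\mathbb{D}$ with multiplicity. Pick matrix: $P_n(f;z_1,\dots,z_n)=\left[\frac{1-f(z_i)\overline{f(z_j)}}{1-z_i\overline{z_j}}\right]_{i,j=1}^n$. $\mathrm{sq}_-P$ = number of negative eigenvalues (with multiplicity). $\mathcal{S}_\kappa$: functions on $\mathbb{D}\setminus\Lambda$ ($\Lambda$ discrete) all of whose Pick matrices at distinct points have at most $\kappa$ negative eigenvalues, at least one having exactly $\kappa$. A standard function is $f(z)=S(z)/B(z)$ for $z\notin\mathcal{W}\cup\mathcal{Z}$, $f(z_j)=\gamma_j$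 for $z_j\in\mathcal{Z}$, where $\mathcal{Z}=\{z_1,\dots,z_\ell\}$, $\mathcal{W}$ are disjoint finite sets of distinct points of $\mathbb{D}$; $B$ a Blaschke product of degree $q$, $S$ a Schur function, $\mathcal{W}\subseteq Z(B)\subseteq\mathcal{W}\cup\mathcal{Z}$, $Z(B)\cap Z(S)=\emptyset$; and $S(z_j)/B(z_j)\neq\gamma_j$ if $z_j\notin Z(B)$. Its domain is $\mathbb{D}\setminus\mathcal{W}$; its poles are the zeros of $B$ (with multiplicity) and its jumps are $z_1,\dots,z_\ell$. It is known (and may be assumed) that every $f\in\mathcal{S}_\kappa$ has a unique extension to a standard function whose jumps lie in $\mathbb{D}\setminus\Lambda$. *)

theory Defs
  imports "HOL-Complex_Analysis.Complex_Analysis" "Jordan_Normal_Form.Char_Poly"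
begin

definition sq_neg :: "complex mat \<Rightarrow> nat" where
  "sq_neg A = (\<Sum>a\<in>{a. eigenvalue A a \<and> a \<in> \<real> \<and> Re a < 0}. order a (char_poly A))"

definition pick_matrix :: "(complex \<Rightarrow> complex) \<Rightarrow> complex list \<Rightarrow> complex mat" where
  "pick_matrix f zs = mat (length zs) (length zs)
     (\<lambda>(i,j). (1 - f (zs!i) * cnj (f (zs!j))) / (1 - zs!i * cnj (zs!j)))"

definition disc :: "complex set" where "disc = ball 0 1"

definition discrete_in_disc :: "complex set \<Rightarrow> bool" where
  "discrete_in_disc L \<longleftrightarrow> L \<subseteq> disc \<and> countable L \<and> (\<forall>z\<in>disc. \<not> z islimpt L)"

definition in_S_kappa :: "nat \<Rightarrow> complex set \<Rightarrow> (complex \<Rightarrow> complex) \<Rightarrow> bool" where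
  "in_S_kappa \<kappa> L f \<longleftrightarrow>
     (\<forall>zs. zs \<noteq> [] \<and> distinct zs \<and> set zs \<subseteq> disc - L \<longrightarrow> sq_neg (pick_matrix f zs) \<le> \<kappa>) \<and>
     (\<exists>zs. zs \<noteq> [] \<and> distinct zs \<and> set zs \<subseteq> disc - L \<and> sq_neg (pick_matrix f zs) = \<kappa>)"

definition schur_function :: "(complex \<Rightarrow> complex) \<Rightarrow> bool" where
  "schur_function S \<longleftrightarrow> S holomorphic_on disc \<and> (\<forall>z\<in>disc. cmod (S z) \<le> 1)"

definition blaschke :: "(complex \<Rightarrow> complex) \<Rightarrow> bool" where
  "blaschke B \<longleftrightarrow> (\<exists>p q :: complex poly. coprime p q \<and>
      (\<forall>z\<in>disc. poly q z \<noteq> 0) \<and>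
      (\<forall>z. cmod z = 1 \<and> poly q z \<noteq> 0 \<longrightarrow> cmod (poly p z / poly q z) = 1) \<and>
      (\<forall>z\<in>disc. B z = poly p z / poly q z))"

definition zero_set :: "(complex \<Rightarrow> complex) \<Rightarrow> complex set" where
  "zero_set g = {z\<in>disc. g z = 0}"

definition blaschke_degree :: "(complex \<Rightarrow> complex) \<Rightarrow> nat" where
  "blaschke_degree B = (\<Sum>a\<in>zero_set B. nat (zorder B a))"

text \<open>g is a standard function with data S, B, jumps Zs with values \<gamma>, and set W
  (domain D - W); g is described on its domain D - W.\<close>
definition standard_function ::
  "(complex \<Rightarrow> complex) \<Rightarrow> (complex \<Rightarrow> complex) \<Rightarrow> (complex \<Rightarrow> complex) \<Rightarrow>
   complex set \<Rightarrow> (complex \<Rightarrow> complex) \<Rightarrow> complex set \<Rightarrow> bool" where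
  "standard_function g S B Zs \<gamma> W \<longleftrightarrow>
     finite Zs \<and> finite W \<and> Zs \<subseteq> disc \<and> W \<subseteq> disc \<and> Zs \<inter> W = {} \<and>
     blaschke B \<and> schur_function S \<and>
     W \<subseteq> zero_set B \<and> zero_set B \<subseteq> W \<union> Zs \<and> zero_set B \<inter> zero_set S = {} \<and>
     (\<forall>z\<in>Zs. z \<notin> zero_set B \<longrightarrow> S z / B z \<noteq> \<gamma> z) \<and>
     (\<forall>z\<in>disc - W. g z = (if z \<in> Zs then \<gamma> z else S z / B z))"

definition k_n :: "nat \<Rightarrow> (complex \<Rightarrow> complex) \<Rightarrow> complex set \<Rightarrow> nat" where
  "k_n n f \<Omega> = Max {sq_neg (pick_matrix f zs) | zs. length zs = n \<and> distinct zs \<and> set zs \<subseteq> \<Omega>}"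

end

theory Submission
  imports Defs "Jordan_Normal_Form.Schur_Decomposition"
begin

text \<open>
  Expanding \<open>1 / (1 - z cnj w)\<close> as a geometric series, the Pick form of a finite measure with
  masses \<open>c x\<close> is \<open>\<Sum>m. |U m|^2 - |V m|^2\<close>, where \<open>U m = \<Sum>x. c x * x^m\<close> and
  \<open>V m = \<Sum>x. c x * f x * x^m\<close>.

  Upper bound: away from the jumps the Pick kernel of \<open>S / B\<close> is, up to a diagonal congruence, the
  Pick kernel of \<open>S\<close> (positive) minus that of \<open>B\<close> (of rank \<open>q\<close>), and each jump adds at most one
  negative square.

  Lower bound: for a zero \<open>a\<close> of \<open>B\<close> of order \<open>r\<close> consider the Taylor functionals
  \<open>F \<mapsto> F^(i)(a) / i!\<close> with \<open>i < r\<close>, and at a jump also \<open>i = r\<close>, corrected by a point mass at \<open>a\<close>.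
  They annihilate all \<open>z^m * B\<close>, so \<open>U = 0\<close>, while the sequences \<open>V\<close> they produce from
  \<open>z^m * S\<close> and the jump values are linearly independent: the form is negative definite on a space of
  dimension \<open>q + \<ell>\<close>. Each functional is a limit, in the norm dual to the supremum over a circle of
  radius \<open>R < 1\<close>, of combinations of point evaluations in \<open>\<Omega>\<close> off the jumps, and negative
  definiteness survives a small perturbation.
\<close>

section \<open>Hermitian matrices and their negative eigenvalues\<close>

lemma homogeneous_system_nontrivial_solution:
  fixes a :: "'m \<Rightarrow> 'i \<Rightarrow> 'a::field"
  assumes "finite M" "finite I" "card M < card I"
  obtains x where "\<exists>i\<in>I. x i \<noteq> 0" "\<forall>m\<in>M. (\<Sum>i\<in>I. x i * a m i) = 0"
proof -
  define n where "n = card I"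
  obtain row where row: "bij_betw row {0..<card M} M"
    using ex_bij_betw_nat_finite[OF \<open>finite M\<close>] by blast
  obtain column where column: "bij_betw column {0..<n} I"
    using ex_bij_betw_nat_finite[OF \<open>finite I\<close>] unfolding n_def by blast
  define r where "r = (\<lambda>k. if k = card M then 0\<^sub>v n else vec n (\<lambda>j. a (row k) (column j)))"
  define A where "A = mat\<^sub>r n n r"
  have A: "A \<in> carrier_mat n n" by (simp add: A_def)
  have "det A = 0"
    unfolding A_def r_def using assms(3) by (intro det_row_0) (auto simp: n_def)
  then obtain v where v: "v \<in> carrier_vec n" "v \<noteq> 0\<^sub>v n" "A *\<^sub>v v = 0\<^sub>v n"
    using det_0_iff_vec_prod_zero_field[OF A] by blast
  define x where "x = (\<lambda>i. v $ the_inv_into {0..<n} column i)"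
  have x_column: "x (column j) = v $ j" if "j < n" for j
    using column that by (simp add: x_def bij_betw_def the_inv_into_f_f)
  show ?thesis
  proof
    obtain j where "j < n" "v $ j \<noteq> 0" using v(1,2) by (metis carrier_vecD eq_vecI index_zero_vec)
    then show "\<exists>i\<in>I. x i \<noteq> 0" using bij_betwE[OF column] x_column by force
    show "\<forall>m\<in>M. (\<Sum>i\<in>I. x i * a m i) = 0"
    proof
      fix m assume "m \<in> M"
      then obtain k where k: "k < card M" "row k = m"
        using row unfolding bij_betw_def by (metis atLeastLessThan_iff imageE)
      have "(\<Sum>i\<in>I. x i * a m i) = (\<Sum>j\<in>{0..<n}. x (column j) * a m (column j))"
        by (rule sum.reindex_bij_betw[OF column, symmetric])
      also have "\<dots> = (A *\<^sub>v v) $ k"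
        using k v(1) assms(3) x_column by (simp add: A_def r_def scalar_prod_def n_def mult.commute)
      finally show "(\<Sum>i\<in>I. x i * a m i) = 0" using v(3) k assms(3) by (simp add: n_def)
    qed
  qed
qed

lemma sum_lincomb_mult:
  fixes w :: "'i \<Rightarrow> 'a::comm_semiring_0"
  shows "(\<Sum>i\<in>A. (\<Sum>k\<in>K. x k * y k i) * w i) = (\<Sum>k\<in>K. x k * (\<Sum>i\<in>A. y k i * w i))"
  unfolding sum_distrib_left sum_distrib_right by (subst sum.swap) (simp add: mult.assoc)

definition cinner :: "nat \<Rightarrow> (nat \<Rightarrow> complex) \<Rightarrow> (nat \<Rightarrow> complex) \<Rightarrow> complex" where
  "cinner n x y = (\<Sum>i<n. x i * cnj (y i))"

lemma cinner_cong:
  "(\<And>i. i < n \<Longrightarrow> x i = x' i) \<Longrightarrow> (\<And>i. i < n \<Longrightarrow> y i = y' i) \<Longrightarrow> cinner n x y = cinner n x' y'"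
  by (simp add: cinner_def)

lemma cinner_commute: "cinner n y x = cnj (cinner n x y)"
  by (simp add: cinner_def cnj_sum mult.commute)

lemma cinner_sum_left: "cinner n (\<lambda>i. \<Sum>k\<in>K. c k * x k i) y = (\<Sum>k\<in>K. c k * cinner n (x k) y)"
  unfolding cinner_def by (rule sum_lincomb_mult)

lemma cinner_diff_left: "cinner n (\<lambda>i. x i - x' i) y = cinner n x y - cinner n x' y"
  by (simp add: cinner_def left_diff_distrib sum_subtractf)

lemma cinner_scale_left: "cinner n (\<lambda>i. c * x i) y = c * cinner n x y"
  by (simp add: cinner_def sum_distrib_left mult.assoc)

lemma cinner_scale_right: "cinner n x (\<lambda>i. c * y i) = cnj c * cinner n x y"
  by (simp add: cinner_def sum_distrib_left mult_ac)

lemma cinner_self: "cinner n x x = of_real (\<Sum>i<n. (cmod (x i))\<^sup>2)"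
  unfolding cinner_def of_real_sum complex_norm_square ..

lemma cinner_self_eq_0_iff: "cinner n x x = 0 \<longleftrightarrow> (\<forall>i<n. x i = 0)"
  unfolding cinner_self of_real_eq_0_iff by (subst sum_nonneg_eq_0_iff) auto

definition orthonormal :: "nat \<Rightarrow> nat \<Rightarrow> (nat \<Rightarrow> nat \<Rightarrow> complex) \<Rightarrow> bool" where
  "orthonormal n m u \<longleftrightarrow> (\<forall>k<m. \<forall>l<m. cinner n (u k) (u l) = (if k = l then 1 else 0))"

lemma orthonormalD:
  "orthonormal n m u \<Longrightarrow> k < m \<Longrightarrow> l < m \<Longrightarrow> cinner n (u k) (u l) = (if k = l then 1 else 0)"
  by (simp add: orthonormal_def)

lemma cinner_lincomb_orthonormal:
  assumes "orthonormal n m u" "k < m"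
  shows "cinner n (\<lambda>i. \<Sum>l<m. c l * u l i) (u k) = c k"
proof -
  have "cinner n (\<lambda>i. \<Sum>l<m. c l * u l i) (u k) = (\<Sum>l<m. c l * (if l = k then 1 else 0))"
    unfolding cinner_sum_left using assms by (intro sum.cong) (auto simp: orthonormalD)
  then show ?thesis using assms(2) by (simp add: if_distrib cong: if_cong)
qed

lemma orthonormal_expansion:
  assumes u: "orthonormal n m u" and x: "\<And>i. i < n \<Longrightarrow> x i = (\<Sum>l<m. c l * u l i)" and "i < n"
  shows "x i = (\<Sum>l<m. cinner n x (u l) * u l i)"
proof -
  have "cinner n x (u l) = c l" if "l < m" for l
    unfolding cinner_lincomb_orthonormal[OF u that, symmetric] using x by (intro cinner_cong) simp_all
  then show ?thesis using x[OF \<open>i < n\<close>] by simp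
qed

definition hermitian_mat :: "nat \<Rightarrow> complex mat \<Rightarrow> bool" where
  "hermitian_mat n A \<longleftrightarrow> A \<in> carrier_mat n n \<and> (\<forall>i<n. \<forall>j<n. cnj (A $$ (i, j)) = A $$ (j, i))"

definition mat_apply :: "nat \<Rightarrow> complex mat \<Rightarrow> (nat \<Rightarrow> complex) \<Rightarrow> nat \<Rightarrow> complex" where
  "mat_apply n A x = (\<lambda>i. \<Sum>j<n. A $$ (i, j) * x j)"

lemma mat_apply_sum: "mat_apply n A (\<lambda>j. \<Sum>k\<in>K. c k * x k j) i = (\<Sum>k\<in>K. c k * mat_apply n A (x k) i)"
  unfolding mat_apply_def sum_distrib_left by (subst sum.swap) (simp add: mult_ac)

lemma mat_apply_diff: "mat_apply n A (\<lambda>j. x j - y j) i = mat_apply n A x i - mat_apply n A y i"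
  by (simp add: mat_apply_def right_diff_distrib sum_subtractf)

lemma mat_apply_scale: "mat_apply n A (\<lambda>j. c * x j) i = c * mat_apply n A x i"
  by (simp add: mat_apply_def sum_distrib_left mult_ac)

lemma hermitian_mat_self_adjoint:
  assumes "hermitian_mat n A"
  shows "cinner n (mat_apply n A x) y = cinner n x (mat_apply n A y)"
proof -
  have "cinner n (mat_apply n A x) y = (\<Sum>j<n. \<Sum>i<n. A $$ (i, j) * x j * cnj (y i))"
    unfolding cinner_def mat_apply_def sum_distrib_right by (rule sum.swap)
  also have "\<dots> = (\<Sum>j<n. \<Sum>i<n. x j * cnj (A $$ (j, i) * y i))"
    using assms unfolding hermitian_mat_def by (intro sum.cong refl) (simp add: mult_ac)
  finally show ?thesis unfolding cinner_def mat_apply_def cnj_sum sum_distrib_left .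
qed

definition eigenpair :: "nat \<Rightarrow> complex mat \<Rightarrow> complex \<Rightarrow> (nat \<Rightarrow> complex) \<Rightarrow> bool" where
  "eigenpair n A \<mu> x \<longleftrightarrow> (\<forall>i<n. mat_apply n A x i = \<mu> * x i)"

lemma cinner_mat_apply_eigenpair:
  assumes "hermitian_mat n A" "eigenpair n A \<mu> u"
  shows "cinner n (mat_apply n A x) u = cnj \<mu> * cinner n x u"
proof -
  have "cinner n (mat_apply n A x) u = cinner n x (mat_apply n A u)"
    by (rule hermitian_mat_self_adjoint[OF assms(1)])
  also have "\<dots> = cinner n x (\<lambda>i. \<mu> * u i)"
    using assms(2) by (intro cinner_cong) (simp_all add: eigenpair_def)
  finally show ?thesis by (simp add: cinner_scale_right)
qed

lemma hermitian_mat_eigenvalue_real: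
  assumes "hermitian_mat n A" "eigenpair n A \<mu> u" "cinner n u u = 1"
  shows "\<mu> \<in> \<real>"
proof -
  have "\<mu> = cinner n (\<lambda>i. \<mu> * u i) u" using assms(3) by (simp add: cinner_scale_left)
  also have "\<dots> = cinner n (mat_apply n A u) u"
    using assms(2) by (intro cinner_cong) (simp_all add: eigenpair_def)
  also have "\<dots> = cnj \<mu>" using cinner_mat_apply_eigenpair[OF assms(1,2)] assms(3) by simp
  finally show ?thesis by (simp add: Reals_cnj_iff)
qed

lemma eigenpair_orthogonal_component:
  assumes A: "hermitian_mat n A" and u: "orthonormal n m u" "\<And>l. l < m \<Longrightarrow> eigenpair n A (\<nu> l) (u l)"
    and p: "\<And>i. i < n \<Longrightarrow> mat_apply n A p i = \<mu> * p i + (\<Sum>l<m. d l * u l i)"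
  defines "z \<equiv> \<lambda>i. p i - (\<Sum>l<m. cinner n p (u l) * u l i)"
  shows "eigenpair n A \<mu> z" and "\<And>k. k < m \<Longrightarrow> cinner n z (u k) = 0"
proof -
  show orth: "cinner n z (u k) = 0" if "k < m" for k
    unfolding z_def cinner_diff_left cinner_lincomb_orthonormal[OF u(1) that] by simp
  define e where "e = (\<lambda>l. d l + (\<mu> - \<nu> l) * cinner n p (u l))"
  have Az: "mat_apply n A z i - \<mu> * z i = (\<Sum>l<m. e l * u l i)" if "i < n" for i
  proof -
    have "mat_apply n A z i = mat_apply n A p i - (\<Sum>l<m. cinner n p (u l) * (\<nu> l * u l i))"
      unfolding z_def mat_apply_diff mat_apply_sum using u(2) that by (simp add: eigenpair_def)
    then show ?thesis
      using p[OF that]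
      by (simp add: z_def e_def algebra_simps sum.distrib sum_subtractf sum_distrib_left)
  qed
  have "e k = 0" if "k < m" for k
  proof -
    have "e k = cinner n (\<lambda>i. mat_apply n A z i - \<mu> * z i) (u k)"
      unfolding cinner_lincomb_orthonormal[OF u(1) that, symmetric]
      using Az by (intro cinner_cong) simp_all
    also have "\<dots> = 0"
      using cinner_mat_apply_eigenpair[OF A u(2)[OF that]] orth[OF that]
      by (simp add: cinner_diff_left cinner_scale_left)
    finally show ?thesis .
  qed
  then show "eigenpair n A \<mu> z" using Az by (simp add: eigenpair_def)
qed

lemma orthonormal_extend:
  assumes u: "orthonormal n m u" and z: "\<And>k. k < m \<Longrightarrow> cinner n z (u k) = 0" "cinner n z z \<noteq> 0"
  obtains s where "s \<noteq> 0" "orthonormal n (Suc m) (u(m := \<lambda>i. s * z i))"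
proof -
  define t where "t = (\<Sum>i<n. (cmod (z i))\<^sup>2)"
  have zz: "cinner n z z = of_real t" by (simp add: cinner_self t_def)
  have "t \<ge> 0" unfolding t_def by (intro sum_nonneg) auto
  with z(2) zz have "t > 0" by (cases "t = 0") auto
  define s where "s = complex_of_real (1 / sqrt t)"
  have "s * cnj s * of_real t = 1"
    using \<open>t > 0\<close> by (simp add: s_def flip: of_real_mult)
  then have "s * (cnj s * cinner n z z) = 1" by (simp add: zz mult.assoc)
  moreover have "cinner n (u k) z = 0" if "k < m" for k using z(1)[OF that] cinner_commute[of n "u k" z] by simp
  ultimately have "orthonormal n (Suc m) (u(m := \<lambda>i. s * z i))"
    using u z(1) unfolding orthonormal_def
    by (auto simp: less_Suc_eq cinner_scale_left cinner_scale_right mult.left_commute)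
  then show ?thesis using that[of s] \<open>t > 0\<close> by (simp add: s_def)
qed

definition independent_family :: "nat \<Rightarrow> (nat \<Rightarrow> nat \<Rightarrow> complex) \<Rightarrow> bool" where
  "independent_family n p \<longleftrightarrow> (\<forall>x. (\<forall>i<n. (\<Sum>k<n. x k * p k i) = 0) \<longrightarrow> (\<forall>k<n. x k = 0))"

lemma independent_familyD:
  "independent_family n p \<Longrightarrow> \<forall>i<n. (\<Sum>k<n. x k * p k i) = 0 \<Longrightarrow> k < n \<Longrightarrow> x k = 0"
  unfolding independent_family_def by (elim allE[of _ x] impE) auto

lemma independent_family_not_in_span:
  fixes p u :: "nat \<Rightarrow> nat \<Rightarrow> complex"
  assumes "independent_family n p" "m < n" and span: "\<And>k i. k < m \<Longrightarrow> i < n \<Longrightarrow> p k i = (\<Sum>l<m. c k l * u l i)"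
  shows "\<exists>i<n. p m i \<noteq> (\<Sum>l<m. d l * u l i)"
proof (rule ccontr)
  define c' where "c' = c(m := d)"
  assume "\<not> ?thesis"
  then have p: "p k i = (\<Sum>l<m. c' k l * u l i)" if "k < Suc m" "i < n" for k i
    using span[of k i] that by (cases "k = m") (auto simp: c'_def)
  obtain x where x: "\<exists>k\<in>{..<Suc m}. x k \<noteq> 0" "\<forall>l\<in>{..<m}. (\<Sum>k<Suc m. x k * c' k l) = 0"
    by (rule homogeneous_system_nontrivial_solution[of "{..<m}" "{..<Suc m}" "\<lambda>l k. c' k l"]) auto
  define y where "y = (\<lambda>k. if k < Suc m then x k else 0)"
  have "(\<Sum>k<n. y k * p k i) = 0" if "i < n" for i
  proof -
    have "(\<Sum>k<n. y k * p k i) = (\<Sum>k<Suc m. x k * p k i)"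
      using \<open>m < n\<close> by (intro sum.mono_neutral_cong_right) (auto simp: y_def)
    also have "\<dots> = (\<Sum>l<m. (\<Sum>k<Suc m. x k * c' k l) * u l i)"
      unfolding sum_lincomb_mult using p that by (intro sum.cong) simp_all
    finally show ?thesis using x(2) by simp
  qed
  moreover obtain k where k: "k < Suc m" "x k \<noteq> 0" using x(1) by auto
  ultimately have "y k = 0" using \<open>m < n\<close> by (intro independent_familyD[OF assms(1)]) simp_all
  then show False using k by (simp add: y_def)
qed

lemma hermitian_mat_triangular_basis_orthonormalization:
  assumes A: "hermitian_mat n A"
    and triangular: "\<forall>k<n. \<forall>i<n. mat_apply n A (p k) i = (\<Sum>l\<le>k. t l k * p l i)"
    and p: "independent_family n p" and "m \<le> n"
  shows "\<exists>u. orthonormal n m u \<and> (\<forall>k<m. eigenpair n A (t k k) (u k)) \<and>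
    (\<forall>k<m. \<forall>i<n. p k i = (\<Sum>l<m. cinner n (p k) (u l) * u l i))"
  using \<open>m \<le> n\<close>
proof (induction m)
  case 0
  show ?case by (simp add: orthonormal_def)
next
  case (Suc m)
  then obtain u where u: "orthonormal n m u" and eig: "\<And>k. k < m \<Longrightarrow> eigenpair n A (t k k) (u k)"
    and expand: "\<And>k i. k < m \<Longrightarrow> i < n \<Longrightarrow> p k i = (\<Sum>l<m. cinner n (p k) (u l) * u l i)"
    by auto
  define z where "z = (\<lambda>i. p m i - (\<Sum>l<m. cinner n (p m) (u l) * u l i))"
  define d where "d = (\<lambda>l. \<Sum>k<m. t k m * cinner n (p k) (u l))"
  have "mat_apply n A (p m) i = t m m * p m i + (\<Sum>l<m. d l * u l i)" if "i < n" for i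
  proof -
    have "(\<Sum>l<m. d l * u l i) = (\<Sum>k<m. t k m * p k i)"
      unfolding d_def sum_lincomb_mult using expand that by (intro sum.cong) simp_all
    then show ?thesis using triangular that Suc.prems by (simp flip: lessThan_Suc_atMost)
  qed
  from eigenpair_orthogonal_component[OF A u eig this, folded z_def]
  have z: "eigenpair n A (t m m) z" "\<And>k. k < m \<Longrightarrow> cinner n z (u k) = 0" by blast+
  have "\<exists>i<n. p m i \<noteq> (\<Sum>l<m. cinner n (p m) (u l) * u l i)"
    by (rule independent_family_not_in_span[where c = "\<lambda>k l. cinner n (p k) (u l)", OF p _ expand])
      (use Suc.prems in simp_all)
  then have "cinner n z z \<noteq> 0" by (auto simp: cinner_self_eq_0_iff z_def)
  then obtain s where s: "s \<noteq> 0" "orthonormal n (Suc m) (u(m := \<lambda>i. s * z i))"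
    using orthonormal_extend[OF u z(2)] by blast
  define u' where "u' = u(m := \<lambda>i. s * z i)"
  have u': "orthonormal n (Suc m) u'" "\<And>k. k < m \<Longrightarrow> u' k = u k" "u' m = (\<lambda>i. s * z i)"
    using s(2) by (auto simp: u'_def)
  have "eigenpair n A (t k k) (u' k)" if "k < Suc m" for k
    using that eig z(1) u'(2,3) by (auto simp: less_Suc_eq eigenpair_def mat_apply_scale)
  moreover have "p k i = (\<Sum>l<Suc m. cinner n (p k) (u' l) * u' l i)" if "k < Suc m" "i < n" for k i
  proof (rule orthonormal_expansion[OF u'(1) _ \<open>i < n\<close>])
    define c where "c = (\<lambda>l. if l < m then cinner n (p k) (u l) else if k = m then 1 / s else 0)"
    show "p k i = (\<Sum>l<Suc m. c l * u' l i)" if "i < n" for i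
      using expand[of k i] that \<open>k < Suc m\<close> s(1) u'(2,3)
      by (cases "k = m") (simp_all add: c_def z_def)
  qed
  ultimately show ?case using u'(1) by blast
qed

lemma complex_mat_triangular_basis:
  assumes A: "A \<in> carrier_mat n n" and es: "char_poly A = (\<Prod>e\<leftarrow>es. [:- e, 1:])" "length es = n"
  obtains p t where "independent_family n p"
    "\<forall>k<n. \<forall>i<n. mat_apply n A (p k) i = (\<Sum>l\<le>k. t l k * p l i)" "\<forall>k<n. t k k = es ! k"
proof -
  obtain T P Q where "schur_decomposition A es = (T, P, Q)" by (metis prod_cases3)
  then have wit: "similar_mat_wit A T P Q" and T: "upper_triangular T" "diag_mat T = es"
    using schur_decomposition[OF A es(1)] by blast+
  note PQ = similar_mat_witD2[OF A wit]
  have AP: "A * P = P * T"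
    using PQ by (metis assoc_mult_mat mult_carrier_mat right_mult_one_mat)
  define p where "p = (\<lambda>k i. P $$ (i, k))"
  have "mat_apply n A (p k) i = (\<Sum>l\<le>k. T $$ (l, k) * p l i)" if "k < n" "i < n" for k i
  proof -
    have "mat_apply n A (p k) i = (A * P) $$ (i, k)"
      using that PQ by (simp add: mat_apply_def p_def scalar_prod_def lessThan_atLeast0)
    also have "\<dots> = (\<Sum>l\<in>{0..<n}. P $$ (i, l) * T $$ (l, k))"
      unfolding AP using that PQ by (simp add: scalar_prod_def)
    also have "\<dots> = (\<Sum>l\<le>k. T $$ (l, k) * p l i)"
      using that PQ(5) upper_triangularD[OF T(1)] by (intro sum.mono_neutral_cong_right) (auto simp: p_def)
    finally show ?thesis .
  qed
  moreover have "independent_family n p"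
    unfolding independent_family_def
  proof (intro allI impI)
    fix x k assume x: "\<forall>i<n. (\<Sum>k<n. x k * p k i) = 0" and "k < n"
    have "P *\<^sub>v vec n x = 0\<^sub>v n"
      using x PQ(6) by (intro eq_vecI) (auto simp: p_def scalar_prod_def lessThan_atLeast0 mult.commute)
    have "vec n x = Q *\<^sub>v (P *\<^sub>v vec n x)"
      using PQ(2,6,7) by (simp flip: assoc_mult_mat_vec)
    also have "\<dots> = 0\<^sub>v n" unfolding \<open>P *\<^sub>v vec n x = 0\<^sub>v n\<close> using PQ(7) by (intro eq_vecI) auto
    finally show "x k = 0" using \<open>k < n\<close> by (metis index_vec index_zero_vec(1))
  qed
  moreover have "T $$ (k, k) = es ! k" if "k < n" for k
    using T(2) PQ(5) that by (auto simp: diag_mat_def)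
  ultimately show ?thesis using that[of p "\<lambda>l k. T $$ (l, k)"] by blast
qed

lemma hermitian_mat_orthonormal_eigenbasis:
  assumes A: "hermitian_mat n A"
  obtains u \<mu> where "orthonormal n n u" "\<And>k. k < n \<Longrightarrow> eigenpair n A (complex_of_real (\<mu> k)) (u k)"
    "char_poly A = (\<Prod>k\<leftarrow>[0..<n]. [:- complex_of_real (\<mu> k), 1:])"
proof -
  have carrier: "A \<in> carrier_mat n n" using A by (simp add: hermitian_mat_def)
  obtain es where es: "char_poly A = (\<Prod>e\<leftarrow>es. [:- e, 1:])" "length es = n"
    using char_poly_factorized[OF carrier] by blast
  obtain p t where p: "independent_family n p"
    "\<forall>k<n. \<forall>i<n. mat_apply n A (p k) i = (\<Sum>l\<le>k. t l k * p l i)" and t: "\<forall>k<n. t k k = es ! k"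
    by (rule complex_mat_triangular_basis[OF carrier es])
  obtain u where u: "orthonormal n n u" "\<And>k. k < n \<Longrightarrow> eigenpair n A (es ! k) (u k)"
    using hermitian_mat_triangular_basis_orthonormalization[OF A p(2,1) order_refl] t by auto
  have real: "complex_of_real (Re (es ! k)) = es ! k" if "k < n" for k
    using hermitian_mat_eigenvalue_real[OF A u(2)] orthonormalD[OF u(1)] that by (simp add: of_real_Re)
  have "es = map (\<lambda>k. complex_of_real (Re (es ! k))) [0..<n]"
    using real es(2) by (intro nth_equalityI) auto
  then have "(\<Prod>e\<leftarrow>es. [:- e, 1:]) = (\<Prod>k\<leftarrow>[0..<n]. [:- complex_of_real (Re (es ! k)), 1:])"
    by (metis (no_types, lifting) list.map_comp comp_def map_eq_conv)
  then show ?thesis using that[of u "\<lambda>k. Re (es ! k)"] u real es(1) by simp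
qed

lemma order_prod_linear:
  fixes c :: "nat \<Rightarrow> 'a::field"
  shows "Polynomial.order a (\<Prod>k\<leftarrow>[0..<n]. [:- c k, 1:]) = card {k. k < n \<and> c k = a}"
proof (induction n)
  case 0
  show ?case by simp
next
  case (Suc n)
  have "Polynomial.order a (\<Prod>k\<leftarrow>[0..<Suc n]. [:- c k, 1:]) =
      Polynomial.order a (\<Prod>k\<leftarrow>[0..<n]. [:- c k, 1:]) + Polynomial.order a [:- c n, 1:]"
    by (simp add: order_mult prod_list_zero_iff image_iff del: mult_pCons_right)
  also have "\<dots> = card {k. k < n \<and> c k = a} + (if c n = a then 1 else 0)"
    using Suc by (simp add: order_linear')
  also have "\<dots> = card {k. k < Suc n \<and> c k = a}"
  proof -
    have "{k. k < Suc n \<and> c k = a} =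
        (if c n = a then insert n {k. k < n \<and> c k = a} else {k. k < n \<and> c k = a})"
      by (auto simp: less_Suc_eq)
    then show ?thesis by simp
  qed
  finally show ?case .
qed

lemma sq_neg_eq_card:
  assumes "A \<in> carrier_mat n n"
    and char_poly: "char_poly A = (\<Prod>k\<leftarrow>[0..<n]. [:- complex_of_real (\<mu> k), 1:])"
  shows "sq_neg A = card {k. k < n \<and> \<mu> k < 0}"
proof -
  define N where "N = {k. k < n \<and> \<mu> k < 0}"
  have "eigenvalue A a \<longleftrightarrow> (\<exists>k<n. complex_of_real (\<mu> k) = a)" for a
    unfolding eigenvalue_root_char_poly[OF assms(1)] char_poly
    by (auto simp: poly_prod_list prod_list_zero_iff)
  then have "{a. eigenvalue A a \<and> a \<in> \<real> \<and> Re a < 0} = (\<lambda>k. complex_of_real (\<mu> k)) ` N"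
    by (auto simp: N_def)
  then have "sq_neg A = (\<Sum>a\<in>(\<lambda>k. complex_of_real (\<mu> k)) ` N. card {k\<in>N. complex_of_real (\<mu> k) = a})"
    unfolding sq_neg_def char_poly order_prod_linear
    by (intro sum.cong arg_cong[where f = card]) (auto simp: N_def)
  also have "\<dots> = card N"
    using sum.image_gen[of N "\<lambda>_. 1::nat" "\<lambda>k. complex_of_real (\<mu> k)"] by (simp add: N_def)
  finally show ?thesis by (simp add: N_def)
qed

definition mat_form :: "nat \<Rightarrow> complex mat \<Rightarrow> (nat \<Rightarrow> complex) \<Rightarrow> complex" where
  "mat_form n A c = (\<Sum>i<n. \<Sum>j<n. c i * cnj (c j) * A $$ (i, j))"

lemma orthonormal_basis_resolution:
  assumes "orthonormal n n u" "i < n" "j < n"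
  shows "(\<Sum>k<n. u k i * cnj (u k j)) = (if i = j then 1 else 0)"
proof -
  define U where "U = mat n n (\<lambda>(i, k). u k i)"
  define V where "V = mat n n (\<lambda>(k, i). cnj (u k i))"
  have carrier: "U \<in> carrier_mat n n" "V \<in> carrier_mat n n" by (auto simp: U_def V_def)
  have "V * U = 1\<^sub>m n"
  proof (rule eq_matI)
    fix k l assume "k < dim_row (1\<^sub>m n)" "l < dim_col (1\<^sub>m n)"
    then show "(V * U) $$ (k, l) = 1\<^sub>m n $$ (k, l)"
      using orthonormalD[OF assms(1), of l k]
      by (simp add: U_def V_def scalar_prod_def cinner_def lessThan_atLeast0 mult.commute)
  qed (use carrier in auto)
  then have "(U * V) $$ (i, j) = 1\<^sub>m n $$ (i, j)"
    using mat_mult_left_right_inverse[OF carrier(2,1)] by simp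
  then show ?thesis
    using assms(2,3) by (simp add: U_def V_def scalar_prod_def lessThan_atLeast0)
qed

lemma mat_form_spectral:
  assumes u: "orthonormal n n u" and eig: "\<And>k. k < n \<Longrightarrow> eigenpair n A (complex_of_real (\<mu> k)) (u k)"
  shows "mat_form n A c = of_real (\<Sum>k<n. \<mu> k * (cmod (\<Sum>i<n. c i * u k i))\<^sup>2)"
proof -
  have entry: "A $$ (i, j) = (\<Sum>k<n. of_real (\<mu> k) * u k i * cnj (u k j))" if "i < n" "j < n" for i j
  proof -
    have "A $$ (i, j) = (\<Sum>l<n. A $$ (i, l) * (\<Sum>k<n. u k l * cnj (u k j)))"
      using that by (simp add: orthonormal_basis_resolution[OF u] if_distrib cong: if_cong)
    also have "\<dots> = (\<Sum>k<n. mat_apply n A (u k) i * cnj (u k j))"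
      unfolding mat_apply_def sum_distrib_left sum_distrib_right by (subst sum.swap) (simp add: mult.assoc)
    also have "\<dots> = (\<Sum>k<n. of_real (\<mu> k) * u k i * cnj (u k j))"
      using eig that by (intro sum.cong) (auto simp: eigenpair_def)
    finally show ?thesis .
  qed
  have "mat_form n A c = (\<Sum>i<n. \<Sum>j<n. \<Sum>k<n. of_real (\<mu> k) * (c i * u k i) * cnj (c j * u k j))"
    unfolding mat_form_def by (intro sum.cong refl) (simp add: entry sum_distrib_left algebra_simps)
  also have "\<dots> = (\<Sum>i<n. \<Sum>k<n. \<Sum>j<n. of_real (\<mu> k) * (c i * u k i) * cnj (c j * u k j))"
    by (intro sum.cong refl sum.swap)
  also have "\<dots> = (\<Sum>k<n. \<Sum>i<n. \<Sum>j<n. of_real (\<mu> k) * (c i * u k i) * cnj (c j * u k j))"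
    by (rule sum.swap)
  also have "\<dots> = (\<Sum>k<n. of_real (\<mu> k) * ((\<Sum>i<n. c i * u k i) * cnj (\<Sum>i<n. c i * u k i)))"
    unfolding cnj_sum sum_product unfolding sum_distrib_left by (simp add: mult.assoc)
  also have "\<dots> = of_real (\<Sum>k<n. \<mu> k * (cmod (\<Sum>i<n. c i * u k i))\<^sup>2)"
    unfolding of_real_sum of_real_mult complex_norm_square ..
  finally show ?thesis .
qed

lemma hermitian_mat_diagonalization:
  assumes "hermitian_mat n A"
  obtains u \<mu> where "orthonormal n n u" "sq_neg A = card {k. k < n \<and> \<mu> k < 0}"
    "\<forall>c. mat_form n A c = of_real (\<Sum>k<n. \<mu> k * (cmod (\<Sum>i<n. c i * u k i))\<^sup>2)"
proof -
  obtain u \<mu> where u: "orthonormal n n u"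
    and eig: "\<And>k. k < n \<Longrightarrow> eigenpair n A (complex_of_real (\<mu> k)) (u k)"
    and char_poly: "char_poly A = (\<Prod>k\<leftarrow>[0..<n]. [:- complex_of_real (\<mu> k), 1:])"
    using hermitian_mat_orthonormal_eigenbasis[OF assms] by blast
  have "sq_neg A = card {k. k < n \<and> \<mu> k < 0}"
    using assms char_poly by (intro sq_neg_eq_card) (simp_all add: hermitian_mat_def)
  then show ?thesis using that u mat_form_spectral[OF u eig] by blast
qed

text \<open>Otherwise some nonzero vector spanned by the eigenvectors with negative eigenvalue, on
  which the form is negative, would satisfy all the equations.\<close>
lemma sq_neg_le_card_equations:
  assumes A: "hermitian_mat n A" and "finite M"
    and nonneg: "\<And>c. (\<And>m. m \<in> M \<Longrightarrow> (\<Sum>i<n. c i * \<phi> m i) = 0) \<Longrightarrow> 0 \<le> Re (mat_form n A c)"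
  shows "sq_neg A \<le> card M"
proof (rule ccontr)
  obtain u \<mu> where u: "orthonormal n n u" and sq_neg: "sq_neg A = card {k. k < n \<and> \<mu> k < 0}"
    and form: "\<forall>c. mat_form n A c = of_real (\<Sum>k<n. \<mu> k * (cmod (\<Sum>i<n. c i * u k i))\<^sup>2)"
    by (rule hermitian_mat_diagonalization[OF A])
  define N where "N = {k. k < n \<and> \<mu> k < 0}"
  have "finite N" by (simp add: N_def)
  assume "\<not> sq_neg A \<le> card M"
  then have "card M < card N" using sq_neg by (simp add: N_def)
  then obtain t where t: "\<exists>k\<in>N. t k \<noteq> 0"
      "\<forall>m\<in>M. (\<Sum>k\<in>N. t k * (\<Sum>i<n. cnj (u k i) * \<phi> m i)) = 0"
    by (rule homogeneous_system_nontrivial_solution[OF \<open>finite M\<close> \<open>finite N\<close>])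
  define c where "c = (\<lambda>i. \<Sum>k\<in>N. t k * cnj (u k i))"
  have "0 \<le> Re (mat_form n A c)"
    using t(2) by (intro nonneg) (simp add: c_def sum_lincomb_mult)
  moreover have "(\<Sum>i<n. c i * u k i) = (if k \<in> N then t k else 0)" if "k < n" for k
  proof -
    have "(\<Sum>i<n. c i * u k i) = (\<Sum>l\<in>N. t l * cinner n (u k) (u l))"
      unfolding c_def sum_lincomb_mult by (simp add: cinner_def mult.commute)
    also have "\<dots> = (\<Sum>l\<in>N. if k = l then t l else 0)"
      using that by (intro sum.cong) (auto simp: N_def orthonormalD[OF u])
    finally show ?thesis using \<open>finite N\<close> by simp
  qed
  ultimately have "0 \<le> (\<Sum>k<n. \<mu> k * (cmod (if k \<in> N then t k else 0))\<^sup>2)" by (simp add: form)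
  moreover obtain k where "k \<in> N" "t k \<noteq> 0" using t(1) by blast
  then have "0 < (\<Sum>k<n. - (\<mu> k * (cmod (if k \<in> N then t k else 0))\<^sup>2))"
    by (intro sum_pos2[of _ k]) (auto simp: N_def mult_neg_pos mult_nonpos_nonneg)
  ultimately show False by (simp add: sum_negf)
qed

text \<open>Otherwise some nontrivial combination would be orthogonal to all eigenvectors with negative
  eigenvalue.\<close>
lemma card_le_sq_neg_of_negative_combinations:
  assumes A: "hermitian_mat n A" and "finite I"
    and neg: "\<And>x. \<exists>\<iota>\<in>I. x \<iota> \<noteq> 0 \<Longrightarrow> Re (mat_form n A (\<lambda>i. \<Sum>\<iota>\<in>I. x \<iota> * X \<iota> i)) < 0"
  shows "card I \<le> sq_neg A"
proof (rule ccontr)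
  obtain u \<mu> where u: "orthonormal n n u" and sq_neg: "sq_neg A = card {k. k < n \<and> \<mu> k < 0}"
    and form: "\<forall>c. mat_form n A c = of_real (\<Sum>k<n. \<mu> k * (cmod (\<Sum>i<n. c i * u k i))\<^sup>2)"
    by (rule hermitian_mat_diagonalization[OF A])
  define N where "N = {k. k < n \<and> \<mu> k < 0}"
  have "finite N" by (simp add: N_def)
  assume "\<not> card I \<le> sq_neg A"
  then have "card N < card I" using sq_neg by (simp add: N_def)
  then obtain x where x: "\<exists>\<iota>\<in>I. x \<iota> \<noteq> 0"
      "\<forall>k\<in>N. (\<Sum>\<iota>\<in>I. x \<iota> * (\<Sum>i<n. X \<iota> i * u k i)) = 0"
    by (rule homogeneous_system_nontrivial_solution[OF \<open>finite N\<close> \<open>finite I\<close>])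
  define c where "c = (\<lambda>i. \<Sum>\<iota>\<in>I. x \<iota> * X \<iota> i)"
  have "(\<Sum>i<n. c i * u k i) = 0" if "k \<in> N" for k
    using x(2) that by (simp add: c_def sum_lincomb_mult)
  then have "0 \<le> \<mu> k * (cmod (\<Sum>i<n. c i * u k i))\<^sup>2" if "k < n" for k
    using that by (cases "k \<in> N") (auto simp: N_def)
  then have "0 \<le> (\<Sum>k<n. \<mu> k * (cmod (\<Sum>i<n. c i * u k i))\<^sup>2)" by (intro sum_nonneg) simp
  then have "0 \<le> Re (mat_form n A c)" by (simp add: form)
  then show False using neg[OF x(1)] by (simp add: c_def)
qed

section \<open>Pick kernels\<close>

lemma one_minus_mult_cnj_nonzero:
  assumes "cmod z \<le> 1" "cmod w < 1"
  shows "1 - z * cnj w \<noteq> 0" "1 - cnj w * z \<noteq> 0"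
proof -
  have "cmod (z * cnj w) < 1"
    using assms mult_left_le_one_le[of "cmod w" "cmod z"] by (simp add: norm_mult)
  then show "1 - z * cnj w \<noteq> 0" by auto
  then show "1 - cnj w * z \<noteq> 0" by (simp add: mult.commute)
qed

definition pick_kernel :: "(complex \<Rightarrow> complex) \<Rightarrow> complex \<Rightarrow> complex \<Rightarrow> complex" where
  "pick_kernel f z w = (1 - f z * cnj (f w)) / (1 - z * cnj w)"

definition pick_form :: "(complex \<Rightarrow> complex) \<Rightarrow> complex set \<Rightarrow> (complex \<Rightarrow> complex) \<Rightarrow> complex" where
  "pick_form f X c = (\<Sum>x\<in>X. \<Sum>y\<in>X. c x * cnj (c y) * pick_kernel f x y)"

lemma pick_matrix_index:
  "i < length zs \<Longrightarrow> j < length zs \<Longrightarrow> pick_matrix f zs $$ (i, j) = pick_kernel f (zs ! i) (zs ! j)"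
  by (simp add: pick_matrix_def pick_kernel_def)

lemma hermitian_mat_pick_matrix: "hermitian_mat (length zs) (pick_matrix f zs)"
  by (auto simp: hermitian_mat_def pick_matrix_def mult.commute)

lemma sum_nth_distinct:
  assumes "distinct zs"
  shows "(\<Sum>i<length zs. g (zs ! i)) = sum g (set zs)"
  by (rule sum.reindex_bij_betw[OF bij_betw_nth]) (use assms in auto)

lemma mat_form_pick_matrix:
  assumes "distinct zs"
  shows "mat_form (length zs) (pick_matrix f zs) (\<lambda>i. c (zs ! i)) = pick_form f (set zs) c"
  unfolding mat_form_def pick_form_def
  by (simp add: pick_matrix_index flip: sum_nth_distinct[OF assms])

lemma sq_neg_pick_matrix_le_card_equations:
  fixes \<phi> :: "'m \<Rightarrow> complex \<Rightarrow> complex"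
  assumes zs: "distinct zs" and "finite M"
    and nonneg: "\<And>c. (\<And>m. m \<in> M \<Longrightarrow> (\<Sum>x\<in>set zs. c x * \<phi> m x) = 0) \<Longrightarrow> 0 \<le> Re (pick_form f (set zs) c)"
  shows "sq_neg (pick_matrix f zs) \<le> card M"
proof (rule sq_neg_le_card_equations[where \<phi> = "\<lambda>m i. \<phi> m (zs ! i)",
      OF hermitian_mat_pick_matrix \<open>finite M\<close>])
  fix c' assume c': "\<And>m. m \<in> M \<Longrightarrow> (\<Sum>i<length zs. c' i * \<phi> m (zs ! i)) = 0"
  define c where "c = c' \<circ> the_inv_into {..<length zs} ((!) zs)"
  have c: "c (zs ! i) = c' i" if "i < length zs" for i
    using zs that by (simp add: c_def the_inv_into_f_f inj_on_nth)
  have "(\<Sum>x\<in>set zs. c x * \<phi> m x) = (\<Sum>i<length zs. c' i * \<phi> m (zs ! i))" for m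
    using c by (simp flip: sum_nth_distinct[OF zs])
  then have "0 \<le> Re (pick_form f (set zs) c)" using c' by (intro nonneg) simp
  also have "pick_form f (set zs) c = mat_form (length zs) (pick_matrix f zs) c'"
    unfolding mat_form_pick_matrix[OF zs, symmetric] using c by (simp add: mat_form_def)
  finally show "0 \<le> Re (mat_form (length zs) (pick_matrix f zs) c')" .
qed

lemma card_le_sq_neg_pick_matrix:
  fixes X :: "'i \<Rightarrow> complex \<Rightarrow> complex"
  assumes zs: "distinct zs" and "finite I"
    and neg: "\<And>t. \<exists>\<iota>\<in>I. t \<iota> \<noteq> 0 \<Longrightarrow> Re (pick_form f (set zs) (\<lambda>x. \<Sum>\<iota>\<in>I. t \<iota> * X \<iota> x)) < 0"
  shows "card I \<le> sq_neg (pick_matrix f zs)"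
proof (rule card_le_sq_neg_of_negative_combinations[where X = "\<lambda>\<iota> i. X \<iota> (zs ! i)",
      OF hermitian_mat_pick_matrix \<open>finite I\<close>])
  fix t :: "'i \<Rightarrow> complex" assume "\<exists>\<iota>\<in>I. t \<iota> \<noteq> 0"
  from neg[OF this]
  show "Re (mat_form (length zs) (pick_matrix f zs) (\<lambda>i. \<Sum>\<iota>\<in>I. t \<iota> * X \<iota> (zs ! i))) < 0"
    by (simp add: mat_form_pick_matrix[OF zs, of f "\<lambda>x. \<Sum>\<iota>\<in>I. t \<iota> * X \<iota> x"])
qed

section \<open>Schur functions\<close>

definition has_circle_mean :: "(complex \<Rightarrow> complex) \<Rightarrow> complex \<Rightarrow> bool" where
  "has_circle_mean F I \<longleftrightarrow> ((\<lambda>t. F (circlepath 0 1 t)) has_integral I) {0..1}"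

lemma has_circle_mean_Re_nonneg:
  assumes "has_circle_mean F I" and "\<And>z. cmod z = 1 \<Longrightarrow> 0 \<le> Re (F z)"
  shows "0 \<le> Re I"
proof (rule has_integral_nonneg)
  show "((\<lambda>t. Re (F (circlepath 0 1 t))) has_integral Re I) {0..1}"
    using assms(1) unfolding has_circle_mean_def by (rule has_integral_Re)
qed (use assms(2) in \<open>simp add: circlepath\<close>)

lemma has_circle_mean_szego:
  assumes F: "continuous_on (cball 0 1) F" "F holomorphic_on ball 0 1" and w: "cmod w < 1"
  shows "has_circle_mean (\<lambda>z. F z * cnj (1 / (1 - cnj w * z))) (F w)"
proof -
  define e where "e = circlepath 0 1"
  have "((\<lambda>z. F z / (z - w)) has_contour_integral 2 * complex_of_real pi * \<i> * F w) e"
    unfolding e_def using Cauchy_integral_circlepath[OF F] w by simp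
  then have "((\<lambda>t. F (e t) / (e t - w) * vector_derivative e (at t within {0..1})) has_integral
      2 * complex_of_real pi * \<i> * F w) {0..1}" by (simp add: has_contour_integral_def)
  from has_integral_divide[OF this, of "2 * complex_of_real pi * \<i>"]
  have "((\<lambda>t. F (e t) / (e t - w) * vector_derivative e (at t within {0..1}) / (2 * complex_of_real pi * \<i>))
      has_integral F w) {0..1}" by simp
  then have "((\<lambda>t. F (e t) * cnj (1 / (1 - cnj w * e t))) has_integral F w) {0..1}"
  proof (rule has_integral_eq[rotated])
    fix t :: real assume t: "t \<in> {0..1}"
    have "e t = exp (2 * of_real pi * \<i> * of_real t)" by (simp add: e_def circlepath)
    then have derivative: "vector_derivative e (at t within {0..1}) = 2 * of_real pi * \<i> * e t"
      using t by (simp add: e_def vector_derivative_circlepath01)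
    have "cmod (e t) = 1" by (simp add: e_def circlepath)
    then have nonzero: "e t \<noteq> 0" "e t - w \<noteq> 0" using w by auto
    have "e t * cnj (e t) = 1" using \<open>cmod (e t) = 1\<close> by (simp add: complex_norm_square[symmetric])
    then have inverse: "cnj (e t) = 1 / e t" using nonzero by (simp add: field_simps)
    have "cnj (1 / (1 - cnj w * e t)) = 1 / (1 - w * cnj (e t))" by simp
    also have "\<dots> = e t / (e t - w)" unfolding inverse using nonzero by (simp add: divide_simps)
    finally have "cnj (1 / (1 - cnj w * e t)) = e t / (e t - w)" .
    then show "F (e t) / (e t - w) * vector_derivative e (at t within {0..1}) / (2 * complex_of_real pi * \<i>) =
        F (e t) * cnj (1 / (1 - cnj w * e t))"
      unfolding derivative by simp
  qed
  then show ?thesis by (simp add: has_circle_mean_def e_def)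
qed

definition szego_combination :: "complex set \<Rightarrow> (complex \<Rightarrow> complex) \<Rightarrow> complex \<Rightarrow> complex" where
  "szego_combination X d z = (\<Sum>x\<in>X. cnj (d x) / (1 - cnj x * z))"

lemma has_circle_mean_szego_combination:
  assumes "continuous_on (cball 0 1) F" "F holomorphic_on ball 0 1"
    and X: "finite X" "\<And>x. x \<in> X \<Longrightarrow> cmod x < 1"
  shows "has_circle_mean (\<lambda>z. F z * cnj (szego_combination X d z)) (\<Sum>x\<in>X. d x * F x)"
proof -
  have "((\<lambda>t. \<Sum>x\<in>X. d x * (F (circlepath 0 1 t) * cnj (1 / (1 - cnj x * circlepath 0 1 t))))
      has_integral (\<Sum>x\<in>X. d x * F x)) {0..1}"
    using X has_circle_mean_szego[OF assms(1,2)] unfolding has_circle_mean_def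
    by (intro has_integral_sum has_integral_mult_right) auto
  then show ?thesis
    by (simp add: has_circle_mean_def szego_combination_def cnj_sum sum_distrib_left mult_ac)
qed

lemma szego_combination_regular:
  assumes "\<And>x. x \<in> X \<Longrightarrow> cmod x < 1"
  shows "continuous_on (cball 0 1) (szego_combination X d)" "szego_combination X d holomorphic_on ball 0 1"
  unfolding szego_combination_def using one_minus_mult_cnj_nonzero(2) assms
  by (auto intro!: continuous_intros holomorphic_intros simp: less_imp_le)

text \<open>With \<open>h\<close> and \<open>g\<close> the combinations of Szego kernels with coefficients \<open>c x\<close> and \<open>c x * S x\<close>,
  the Pick form is the mean over the circle of \<open>|h|^2 - 2 Re (S g cnj h) + |g|^2\<close>.\<close>
lemma pick_form_nonneg_closed_disc:
  assumes S: "continuous_on (cball 0 1) S" "S holomorphic_on ball 0 1" "\<And>z. cmod z \<le> 1 \<Longrightarrow> cmod (S z) \<le> 1"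
    and X: "finite X" "\<And>x. x \<in> X \<Longrightarrow> cmod x < 1"
  shows "0 \<le> Re (pick_form S X c)"
proof -
  define h where "h = szego_combination X c"
  define g where "g = szego_combination X (\<lambda>x. c x * S x)"
  note regular = szego_combination_regular[OF X(2)]
  define a where "a = (\<Sum>x\<in>X. c x * h x)"
  define b where "b = (\<Sum>x\<in>X. c x * (S x * g x))"
  have "has_circle_mean (\<lambda>z. h z * cnj (h z)) a"
    unfolding h_def a_def by (intro has_circle_mean_szego_combination regular X)
  moreover have "has_circle_mean (\<lambda>z. S z * g z * cnj (h z)) b"
    unfolding h_def g_def b_def
    by (intro has_circle_mean_szego_combination continuous_on_mult holomorphic_on_mult regular S X)
  moreover have "has_circle_mean (\<lambda>z. g z * cnj (g z)) b"
    using has_circle_mean_szego_combination[where d = "\<lambda>x. c x * S x", OF regular X]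
    by (simp add: g_def b_def mult.assoc)
  ultimately have "has_circle_mean
      (\<lambda>z. h z * cnj (h z) - 2 * (S z * g z * cnj (h z)) + g z * cnj (g z)) (a - 2 * b + b)"
    unfolding has_circle_mean_def by (intro has_integral_add has_integral_diff has_integral_mult_right)
  then have "0 \<le> Re (a - 2 * b + b)"
  proof (rule has_circle_mean_Re_nonneg)
    fix z :: complex assume "cmod z = 1"
    have "Re (S z * g z * cnj (h z)) \<le> cmod (S z) * (cmod (g z) * cmod (h z))"
      using complex_Re_le_cmod[of "S z * g z * cnj (h z)"] by (simp add: norm_mult mult.assoc)
    also have "\<dots> \<le> cmod (g z) * cmod (h z)"
      using S(3)[of z] \<open>cmod z = 1\<close> by (intro mult_left_le_one_le) auto
    finally have "2 * Re (S z * g z * cnj (h z)) \<le> (cmod (g z))\<^sup>2 + (cmod (h z))\<^sup>2"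
      using sum_squares_bound[of "cmod (g z)" "cmod (h z)"] by simp
    then show "0 \<le> Re (h z * cnj (h z) - 2 * (S z * g z * cnj (h z)) + g z * cnj (g z))"
      by (simp add: complex_mult_cnj cmod_power2)
  qed
  moreover have "a - b = pick_form S X c"
    unfolding a_def b_def h_def g_def szego_combination_def pick_form_def pick_kernel_def
      sum_distrib_left sum_subtractf[symmetric]
    by (intro sum.cong refl) (simp add: diff_divide_distrib algebra_simps)
  ultimately show ?thesis by (simp add: algebra_simps)
qed

lemma schur_function_dilation:
  assumes S: "schur_function S" and r: "0 \<le> r" "r < 1"
  defines "T \<equiv> \<lambda>z. S (of_real r * z)"
  shows "T holomorphic_on cball 0 1" and "\<And>z. cmod z \<le> 1 \<Longrightarrow> cmod (T z) \<le> 1"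
proof -
  have disc: "of_real r * z \<in> disc" if "cmod z \<le> 1" for z :: complex
    using r that mult_left_le[of "cmod z" r] by (simp add: disc_def norm_mult)
  then have "(S \<circ> (\<lambda>z. of_real r * z)) holomorphic_on cball 0 1"
    using S unfolding schur_function_def
    by (intro holomorphic_on_compose_gen[where t = disc] holomorphic_intros) auto
  then show "T holomorphic_on cball 0 1" by (simp add: T_def o_def)
  show "cmod (T z) \<le> 1" if "cmod z \<le> 1" for z
    using S disc[OF that] by (simp add: T_def schur_function_def)
qed

lemma schur_pick_form_nonneg:
  assumes S: "schur_function S" and X: "finite X" "X \<subseteq> disc"
  shows "0 \<le> Re (pick_form S X c)"
proof -
  define r where "r = (\<lambda>n. 1 - inverse (real (Suc n)))"
  have r: "0 \<le> r n" "r n < 1" for n by (auto simp: r_def field_simps)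
  have r_lim: "r \<longlonglongrightarrow> 1"
    unfolding r_def using tendsto_diff[OF tendsto_const LIMSEQ_inverse_real_of_nat, of 1] by simp
  define T where "T = (\<lambda>n z. S (of_real (r n) * z))"
  have norm_X: "cmod x < 1" if "x \<in> X" for x using X that by (auto simp: disc_def)
  have "0 \<le> Re (pick_form (T n) X c)" for n
  proof (rule pick_form_nonneg_closed_disc)
    have hol: "T n holomorphic_on cball 0 1"
      using schur_function_dilation(1)[OF S r] by (simp add: T_def)
    show "continuous_on (cball 0 1) (T n)" using hol by (rule holomorphic_on_imp_continuous_on)
    show "T n holomorphic_on ball 0 1" using hol by (rule holomorphic_on_subset) auto
    show "cmod (T n z) \<le> 1" if "cmod z \<le> 1" for z
      using schur_function_dilation(2)[OF S r that] by (simp add: T_def)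
  qed (use X norm_X in auto)
  moreover have "(\<lambda>n. T n x) \<longlonglongrightarrow> S x" if "x \<in> X" for x
  proof -
    have "isCont S x"
      using S X that unfolding schur_function_def disc_def
      by (auto dest!: holomorphic_on_imp_continuous_on simp: continuous_on_eq_continuous_at)
    moreover have "(\<lambda>n. of_real (r n) * x) \<longlonglongrightarrow> of_real 1 * x" by (intro tendsto_intros r_lim)
    ultimately show ?thesis unfolding T_def by (intro isCont_tendsto_compose[of x S]) auto
  qed
  then have "(\<lambda>n. Re (pick_form (T n) X c)) \<longlonglongrightarrow> Re (pick_form S X c)"
    unfolding pick_form_def pick_kernel_def
    using norm_X one_minus_mult_cnj_nonzero(1)[OF less_imp_le] by (intro tendsto_intros) auto
  ultimately show ?thesis by (intro LIMSEQ_le_const) auto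
qed

section \<open>Blaschke products\<close>

lemma continuous_on_eq_of_eq_off_finite:
  fixes f g :: "'a::metric_space \<Rightarrow> 'b::t2_space"
  assumes S: "connected S" "\<And>x. S \<noteq> {x}" and cont: "continuous_on S f" "continuous_on S g"
    and "finite Z" and eq: "\<And>x. x \<in> S - Z \<Longrightarrow> f x = g x" and "x \<in> S"
  shows "f x = g x"
proof -
  have "x islimpt S" using S \<open>x \<in> S\<close> by (intro connected_imp_perfect)
  then have "x islimpt (S - Z) \<union> Z" by (rule islimpt_subset) auto
  then have "x islimpt S - Z" using \<open>finite Z\<close> islimpt_Un islimpt_finite by blast
  then have "at x within S - Z \<noteq> bot" by (simp add: trivial_limit_within)
  moreover have "(f \<longlongrightarrow> f x) (at x within S - Z)" "(g \<longlongrightarrow> g x) (at x within S - Z)"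
    using cont \<open>x \<in> S\<close> by (auto simp: continuous_on_def intro: tendsto_within_subset)
  moreover have "\<forall>\<^sub>F y in at x within S - Z. f y = g y" using eq by (simp add: eventually_at_filter)
  ultimately show ?thesis using tendsto_cong tendsto_unique by metis
qed

lemma holomorphic_unimodular_on_circle_constant:
  assumes h: "h holomorphic_on cball 0 1" "\<And>z. cmod z \<le> 1 \<Longrightarrow> h z \<noteq> 0"
    and unimodular: "\<And>z. cmod z = 1 \<Longrightarrow> cmod (h z) = 1"
  obtains \<kappa> where "cmod \<kappa> = 1" "\<forall>z. cmod z < 1 \<longrightarrow> h z = \<kappa>"
proof -
  have cont: "continuous_on (cball 0 1) h" using h(1) by (rule holomorphic_on_imp_continuous_on)
  have hol: "h holomorphic_on ball 0 1" using h(1) by (rule holomorphic_on_subset) auto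
  have norm_h: "cmod (h z) = 1" if "cmod z < 1" for z
  proof (rule antisym)
    show "cmod (h z) \<le> 1"
      using maximum_modulus_frontier[of h "ball 0 1" 1 z] hol cont unimodular that by auto
    have "cmod (inverse (h z)) \<le> 1"
    proof (rule maximum_modulus_frontier[of "\<lambda>z. inverse (h z)" "ball 0 1" 1 z])
      show "(\<lambda>z. inverse (h z)) holomorphic_on interior (ball 0 1)"
        using hol h(2) by (intro holomorphic_intros) auto
      show "continuous_on (closure (ball 0 1)) (\<lambda>z. inverse (h z))"
        using cont h(2) by (intro continuous_intros) auto
    qed (use unimodular that in \<open>auto simp: norm_inverse\<close>)
    then show "1 \<le> cmod (h z)" using h(2)[of z] that by (simp add: norm_inverse inverse_le_1_iff)
  qed
  then have "h constant_on ball 0 1"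
    by (intro maximum_modulus_principle[where U = "ball 0 1" and \<xi> = 0] hol) auto
  then obtain \<kappa> where "\<And>z. z \<in> ball 0 1 \<Longrightarrow> h z = \<kappa>" unfolding constant_on_def by blast
  then show ?thesis using norm_h[of 0] that[of \<kappa>] by simp
qed

lemma norm_circle_reflection:
  assumes "cmod z = R" "R > 0"
  shows "cmod (of_real R - cnj a * z / of_real R) = cmod (z - a)"
proof -
  have "z * cnj z = of_real R * of_real R"
    using assms(1) by (simp add: complex_norm_square[symmetric] power2_eq_square)
  then have "of_real R - cnj a * z / of_real R = z / of_real R * cnj (z - a)"
    using \<open>R > 0\<close> by (simp add: field_simps)
  then show ?thesis using assms by (simp only: norm_mult norm_divide complex_mod_cnj) simp
qed

lemma blaschke_as_fraction:
  assumes "blaschke B"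
  obtains p q where "\<And>z. z \<in> disc \<Longrightarrow> B z = poly p z / poly q z"
    "\<And>z. cmod z \<le> 1 \<Longrightarrow> poly q z \<noteq> 0" "\<And>z. cmod z = 1 \<Longrightarrow> poly p z \<noteq> 0"
    "\<And>z. cmod z = 1 \<Longrightarrow> cmod (poly p z) = cmod (poly q z)"
proof -
  from assms obtain p q where pq: "coprime p q" "\<And>z. z \<in> disc \<Longrightarrow> poly q z \<noteq> 0"
    "\<And>z. cmod z = 1 \<Longrightarrow> poly q z \<noteq> 0 \<Longrightarrow> cmod (poly p z / poly q z) = 1"
    "\<And>z. z \<in> disc \<Longrightarrow> B z = poly p z / poly q z"
    unfolding blaschke_def by blast
  have "q \<noteq> 0" using pq(2)[of 0] by (auto simp: disc_def)
  have norm_eq: "cmod (poly p z) = cmod (poly q z)" if "cmod z = 1" for z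
  proof (rule continuous_on_eq_of_eq_off_finite[where S = "sphere 0 1" and
        f = "\<lambda>z. cmod (poly p z)" and g = "\<lambda>z. cmod (poly q z)" and Z = "{z. poly q z = 0}"])
    have "1 \<in> sphere (0::complex) 1" "-1 \<in> sphere (0::complex) 1" "(1::complex) \<noteq> -1" by auto
    then show "sphere 0 1 \<noteq> {w}" for w :: complex by (metis singletonD)
    show "finite {z. poly q z = 0}" using \<open>q \<noteq> 0\<close> by (rule poly_roots_finite)
    show "cmod (poly p z) = cmod (poly q z)" if "z \<in> sphere 0 1 - {z. poly q z = 0}" for z
      using pq(3)[of z] that by (simp add: norm_divide)
  qed (auto intro!: continuous_intros simp: that connected_sphere)
  have nonzero: "poly p z \<noteq> 0" "poly q z \<noteq> 0" if "cmod z = 1" for z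
    using coprime_poly_0[OF pq(1), of z] norm_eq[OF that] by auto
  moreover have "poly q z \<noteq> 0" if "cmod z \<le> 1" for z
    using that pq(2)[of z] nonzero(2)[of z] by (cases "cmod z = 1") (auto simp: disc_def)
  ultimately show ?thesis using that[of p q] pq(4) norm_eq by blast
qed

lemma poly_split_disc_roots:
  fixes p :: "complex poly"
  assumes "p \<noteq> 0" and "\<And>z. cmod z = 1 \<Longrightarrow> poly p z \<noteq> 0"
  defines "A \<equiv> {z\<in>disc. poly p z = 0}"
  obtains p' where "\<And>z. poly p z = (\<Prod>a\<in>A. (z - a) ^ Polynomial.order a p) * poly p' z"
    "\<And>z. cmod z \<le> 1 \<Longrightarrow> poly p' z \<noteq> 0"
proof -
  define Z where "Z = {z. poly p z = 0}"
  have "finite Z" "A \<subseteq> Z" using poly_roots_finite[OF assms(1)] by (auto simp: Z_def A_def)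
  define p' where "p' = Polynomial.smult (lead_coeff p) (\<Prod>a\<in>Z - A. [:- a, 1:] ^ Polynomial.order a p)"
  have "poly p z = lead_coeff p * (\<Prod>a\<in>Z. (z - a) ^ Polynomial.order a p)" for z
    by (subst complex_poly_decompose[of p, symmetric]) (simp add: poly_prod Z_def)
  also have "\<dots> z = (\<Prod>a\<in>A. (z - a) ^ Polynomial.order a p) * poly p' z" for z
    using prod.subset_diff[OF \<open>A \<subseteq> Z\<close> \<open>finite Z\<close>, of "\<lambda>a. (z - a) ^ Polynomial.order a p"]
    by (simp add: p'_def poly_prod mult_ac)
  finally have "poly p z = (\<Prod>a\<in>A. (z - a) ^ Polynomial.order a p) * poly p' z" for z .
  moreover have "poly p' z \<noteq> 0" if "cmod z \<le> 1" for z
  proof -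
    have "z \<notin> Z - A" using that assms(2)[of z] by (auto simp: Z_def A_def disc_def)
    then show ?thesis using \<open>p \<noteq> 0\<close> \<open>finite Z\<close> by (auto simp: p'_def poly_prod)
  qed
  ultimately show ?thesis using that by blast
qed

definition moebius_product :: "complex set \<Rightarrow> (complex \<Rightarrow> nat) \<Rightarrow> complex \<Rightarrow> complex" where
  "moebius_product A r z = (\<Prod>a\<in>A. Moebius_function 0 a z ^ r a)"

lemma moebius_product_holomorphic:
  assumes "A \<subseteq> disc"
  shows "moebius_product A r holomorphic_on disc"
  unfolding moebius_product_def disc_def using assms
  by (intro holomorphic_intros Moebius_function_holomorphic) (auto simp: disc_def)

lemma blaschke_unimodular_mult_moebius_product:
  assumes "blaschke B"
  obtains \<kappa> r where "finite (zero_set B)" "cmod \<kappa> = 1"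
    "\<And>z. z \<in> disc \<Longrightarrow> B z = \<kappa> * moebius_product (zero_set B) r z"
proof -
  obtain p q where pq: "\<And>z. z \<in> disc \<Longrightarrow> B z = poly p z / poly q z"
    "\<And>z. cmod z \<le> 1 \<Longrightarrow> poly q z \<noteq> 0" "\<And>z. cmod z = 1 \<Longrightarrow> poly p z \<noteq> 0"
    "\<And>z. cmod z = 1 \<Longrightarrow> cmod (poly p z) = cmod (poly q z)"
    using blaschke_as_fraction[OF assms] by metis
  have "p \<noteq> 0" using pq(3)[of 1] by auto
  define A where "A = zero_set B"
  have A: "A = {z\<in>disc. poly p z = 0}" using pq(1,2) by (auto simp: A_def zero_set_def disc_def)
  have "finite A" using poly_roots_finite[OF \<open>p \<noteq> 0\<close>] by (simp add: A)
  define r where "r = (\<lambda>a. Polynomial.order a p)"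
  obtain p' where p': "\<And>z. poly p z = (\<Prod>a\<in>A. (z - a) ^ r a) * poly p' z"
    "\<And>z. cmod z \<le> 1 \<Longrightarrow> poly p' z \<noteq> 0"
    using poly_split_disc_roots[OF \<open>p \<noteq> 0\<close> pq(3)] unfolding A r_def by metis
  define C where "C = (\<lambda>z. \<Prod>a\<in>A. (1 - cnj a * z) ^ r a)"
  have C_nonzero: "C z \<noteq> 0" if "cmod z \<le> 1" for z
    using \<open>finite A\<close> one_minus_mult_cnj_nonzero(2)[OF that] by (auto simp: C_def A disc_def)
  obtain \<kappa> where \<kappa>: "cmod \<kappa> = 1" "\<forall>z. cmod z < 1 \<longrightarrow> poly p' z * C z / poly q z = \<kappa>"
  proof (rule holomorphic_unimodular_on_circle_constant)
    show "(\<lambda>z. poly p' z * C z / poly q z) holomorphic_on cball 0 1"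
      unfolding C_def using pq(2) by (intro holomorphic_intros) auto
    show "poly p' z * C z / poly q z \<noteq> 0" if "cmod z \<le> 1" for z
      using p'(2) C_nonzero pq(2) that by simp
    show "cmod (poly p' z * C z / poly q z) = 1" if "cmod z = 1" for z
    proof -
      have "cmod (C z) = cmod (\<Prod>a\<in>A. (z - a) ^ r a)"
        by (simp add: C_def prod_norm[symmetric] norm_power norm_circle_reflection[OF that, simplified])
      then have "cmod (poly p' z * C z / poly q z) = cmod (poly p z) / cmod (poly q z)"
        by (simp add: norm_divide norm_mult p'(1) mult.commute)
      then show ?thesis using pq(2)[of z] pq(4)[OF that] that by simp
    qed
  qed
  have "B z = \<kappa> * moebius_product A r z" if "z \<in> disc" for z
  proof -
    have "moebius_product A r z = (\<Prod>a\<in>A. (z - a) ^ r a) / C z"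
      by (simp add: moebius_product_def Moebius_function_simple C_def power_divide prod_dividef)
    then show ?thesis
      using pq(1)[OF that] \<kappa>(2)[rule_format, of z] C_nonzero[of z] that by (auto simp: p'(1) disc_def)
  qed
  then show ?thesis using that \<open>finite A\<close> \<kappa>(1) unfolding A_def by blast
qed

lemma zorder_moebius_product:
  assumes A: "finite A" "A \<subseteq> disc" "a \<in> A" and "\<kappa> \<noteq> 0"
    and f: "\<And>z. z \<in> disc \<Longrightarrow> f z = \<kappa> * moebius_product A r z"
  shows "zorder f a = int (r a)"
proof -
  define b where "b = (\<lambda>z. \<kappa> * (1 / (1 - cnj a * z)) ^ r a * moebius_product (A - {a}) r z)"
  have "a \<in> disc" using A by auto
  have nonzero: "1 - cnj x * z \<noteq> 0" if "x \<in> disc" "z \<in> disc" for x z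
    using one_minus_mult_cnj_nonzero(2)[of z x] that by (auto simp: disc_def)
  show ?thesis
  proof (rule zorder_eqI)
    show "open disc" by (simp add: disc_def)
    show "b holomorphic_on disc"
      unfolding b_def using nonzero \<open>a \<in> disc\<close> A(2)
      by (intro holomorphic_intros moebius_product_holomorphic) auto
    show "b a \<noteq> 0"
      using A nonzero \<open>a \<in> disc\<close> \<open>\<kappa> \<noteq> 0\<close>
      by (auto simp: b_def moebius_product_def Moebius_function_simple)
    show "f z = b z * (z - a) powi int (r a)" if "z \<in> disc" for z
      using f[OF that] A(1,3)
      by (simp add: b_def moebius_product_def prod.remove[OF A(1,3)] Moebius_function_simple power_divide)
  qed (rule \<open>a \<in> disc\<close>)
qed

lemma blaschke_moebius_factorization:
  assumes "blaschke B"
  obtains \<kappa> where "finite (zero_set B)" "cmod \<kappa> = 1"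
    "\<And>z. z \<in> disc \<Longrightarrow> B z = \<kappa> * moebius_product (zero_set B) (\<lambda>a. nat (zorder B a)) z"
proof -
  obtain \<kappa> r where B: "finite (zero_set B)" "cmod \<kappa> = 1"
    "\<And>z. z \<in> disc \<Longrightarrow> B z = \<kappa> * moebius_product (zero_set B) r z"
    using blaschke_unimodular_mult_moebius_product[OF assms] by metis
  have "\<kappa> \<noteq> 0" using B(2) by auto
  then have "nat (zorder B a) = r a" if "a \<in> zero_set B" for a
    using zorder_moebius_product[OF B(1) _ that _ B(3)] by (auto simp: zero_set_def)
  then have "moebius_product (zero_set B) (\<lambda>a. nat (zorder B a)) = moebius_product (zero_set B) r"
    by (simp add: fun_eq_iff moebius_product_def)
  then show ?thesis using that B by metis
qed

lemma blaschke_holomorphic: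
  assumes "blaschke B"
  shows "B holomorphic_on disc"
proof -
  obtain \<kappa> where "\<And>z. z \<in> disc \<Longrightarrow> B z = \<kappa> * moebius_product (zero_set B) (\<lambda>a. nat (zorder B a)) z"
    using blaschke_moebius_factorization[OF assms] by metis
  moreover have "zero_set B \<subseteq> disc" by (auto simp: zero_set_def)
  ultimately show ?thesis
    by (intro holomorphic_transform[OF holomorphic_on_mult[OF holomorphic_on_const moebius_product_holomorphic]])
      auto
qed

definition pick_kernel_rank_le :: "(complex \<Rightarrow> complex) \<Rightarrow> nat \<Rightarrow> bool" where
  "pick_kernel_rank_le B q \<longleftrightarrow>
     (\<exists>E. \<forall>z\<in>disc. \<forall>w\<in>disc. pick_kernel B z w = (\<Sum>k<q. E k z * cnj (E k w)))"

lemma pick_kernel_rank_le_const: "cmod \<kappa> = 1 \<Longrightarrow> pick_kernel_rank_le (\<lambda>_. \<kappa>) 0"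
  by (simp add: pick_kernel_rank_le_def pick_kernel_def complex_norm_square[symmetric])

lemma pick_kernel_rank_le_moebius:
  assumes "a \<in> disc"
  shows "pick_kernel_rank_le (Moebius_function 0 a) 1"
proof -
  define s where "s = complex_of_real (sqrt (1 - (cmod a)\<^sup>2))"
  have "(cmod a)\<^sup>2 \<le> 1" using assms by (simp add: disc_def power_le_one)
  then have s: "s * cnj s = 1 - a * cnj a"
    by (simp add: s_def complex_norm_square[symmetric] flip: of_real_mult)
  have "pick_kernel (Moebius_function 0 a) z w = s / (1 - cnj a * z) * cnj (s / (1 - cnj a * w))"
    if "z \<in> disc" "w \<in> disc" for z w
  proof -
    have nonzero: "1 - cnj a * z \<noteq> 0" "1 - a * cnj w \<noteq> 0" "1 - z * cnj w \<noteq> 0"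
      using one_minus_mult_cnj_nonzero[of z a] one_minus_mult_cnj_nonzero[of a w]
        one_minus_mult_cnj_nonzero[of z w] assms that by (auto simp: disc_def)
    have "1 - Moebius_function 0 a z * cnj (Moebius_function 0 a w) =
        ((1 - cnj a * z) * (1 - a * cnj w) - (z - a) * cnj (w - a)) / ((1 - cnj a * z) * (1 - a * cnj w))"
      using nonzero by (simp add: Moebius_function_simple divide_simps)
    also have "(1 - cnj a * z) * (1 - a * cnj w) - (z - a) * cnj (w - a) = (1 - z * cnj w) * (s * cnj s)"
      unfolding s by (simp add: algebra_simps)
    finally show ?thesis using nonzero by (simp add: pick_kernel_def)
  qed
  then show ?thesis
    unfolding pick_kernel_rank_le_def by (intro exI[of _ "\<lambda>_ z. s / (1 - cnj a * z)"]) simp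
qed

lemma pick_kernel_rank_le_mult:
  assumes "pick_kernel_rank_le B\<^sub>1 q\<^sub>1" "pick_kernel_rank_le B\<^sub>2 q\<^sub>2"
  shows "pick_kernel_rank_le (\<lambda>z. B\<^sub>1 z * B\<^sub>2 z) (q\<^sub>1 + q\<^sub>2)"
proof -
  from assms obtain E\<^sub>1 E\<^sub>2 where
    E\<^sub>1: "\<And>z w. z \<in> disc \<Longrightarrow> w \<in> disc \<Longrightarrow> pick_kernel B\<^sub>1 z w = (\<Sum>k<q\<^sub>1. E\<^sub>1 k z * cnj (E\<^sub>1 k w))" and
    E\<^sub>2: "\<And>z w. z \<in> disc \<Longrightarrow> w \<in> disc \<Longrightarrow> pick_kernel B\<^sub>2 z w = (\<Sum>k<q\<^sub>2. E\<^sub>2 k z * cnj (E\<^sub>2 k w))"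
    unfolding pick_kernel_rank_le_def by blast
  define E where "E = (\<lambda>k z. if k < q\<^sub>1 then E\<^sub>1 k z else B\<^sub>1 z * E\<^sub>2 (k - q\<^sub>1) z)"
  have "pick_kernel (\<lambda>z. B\<^sub>1 z * B\<^sub>2 z) z w = (\<Sum>k<q\<^sub>1 + q\<^sub>2. E k z * cnj (E k w))"
    if "z \<in> disc" "w \<in> disc" for z w
  proof -
    have "pick_kernel (\<lambda>z. B\<^sub>1 z * B\<^sub>2 z) z w =
        pick_kernel B\<^sub>1 z w + B\<^sub>1 z * cnj (B\<^sub>1 w) * pick_kernel B\<^sub>2 z w"
      unfolding pick_kernel_def by (simp add: add_divide_distrib[symmetric] algebra_simps)
    also have "\<dots> = (\<Sum>k<q\<^sub>1. E k z * cnj (E k w)) + (\<Sum>k<q\<^sub>2. E (q\<^sub>1 + k) z * cnj (E (q\<^sub>1 + k) w))"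
      by (simp add: E\<^sub>1 E\<^sub>2 that E_def sum_distrib_left mult_ac)
    also have "\<dots> = (\<Sum>k<q\<^sub>1 + q\<^sub>2. E k z * cnj (E k w))"
      by (induction q\<^sub>2) (simp_all add: add.assoc)
    finally show ?thesis .
  qed
  then show ?thesis unfolding pick_kernel_rank_le_def by blast
qed

lemma pick_kernel_rank_le_power:
  assumes "pick_kernel_rank_le B q"
  shows "pick_kernel_rank_le (\<lambda>z. B z ^ n) (n * q)"
proof (induction n)
  case 0
  show ?case using pick_kernel_rank_le_const[of 1] by simp
next
  case (Suc n)
  from pick_kernel_rank_le_mult[OF assms this] show ?case by simp
qed

lemma pick_kernel_rank_le_prod:
  assumes "finite A" "\<And>a. a \<in> A \<Longrightarrow> pick_kernel_rank_le (B a) (q a)"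
  shows "pick_kernel_rank_le (\<lambda>z. \<Prod>a\<in>A. B a z) (\<Sum>a\<in>A. q a)"
  using assms
proof (induction A rule: finite_induct)
  case empty
  show ?case using pick_kernel_rank_le_const[of 1] by simp
next
  case (insert a A)
  then have "pick_kernel_rank_le (\<lambda>z. B a z * (\<Prod>a\<in>A. B a z)) (q a + (\<Sum>a\<in>A. q a))"
    by (intro pick_kernel_rank_le_mult) auto
  then show ?case using insert.hyps by simp
qed

lemma pick_kernel_rank_le_blaschke:
  assumes "blaschke B"
  shows "pick_kernel_rank_le B (blaschke_degree B)"
proof -
  define r where "r = (\<lambda>a. nat (zorder B a))"
  obtain \<kappa> where B: "finite (zero_set B)" "cmod \<kappa> = 1"
    "\<And>z. z \<in> disc \<Longrightarrow> B z = \<kappa> * moebius_product (zero_set B) r z"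
    using blaschke_moebius_factorization[OF assms] unfolding r_def by metis
  have "pick_kernel_rank_le (\<lambda>z. Moebius_function 0 a z ^ r a) (r a * 1)" if "a \<in> zero_set B" for a
    using that by (intro pick_kernel_rank_le_power pick_kernel_rank_le_moebius) (simp add: zero_set_def)
  then have "pick_kernel_rank_le (\<lambda>z. \<kappa> * moebius_product (zero_set B) r z) (0 + (\<Sum>a\<in>zero_set B. r a))"
    unfolding moebius_product_def using B(1,2)
    by (intro pick_kernel_rank_le_mult pick_kernel_rank_le_const pick_kernel_rank_le_prod) simp_all
  then show ?thesis
    using B(3) by (simp add: pick_kernel_rank_le_def pick_kernel_def blaschke_degree_def r_def)
qed

section \<open>The upper bound\<close>

lemma pick_form_quotient:
  assumes X: "X \<subseteq> disc" and f: "\<And>x. x \<in> X \<Longrightarrow> B x \<noteq> 0 \<and> f x = S x / B x"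
    and E: "\<And>z w. z \<in> disc \<Longrightarrow> w \<in> disc \<Longrightarrow> pick_kernel B z w = (\<Sum>k<q. E k z * cnj (E k w))"
  shows "pick_form f X c = pick_form S X (\<lambda>x. c x / B x) -
    (\<Sum>k<q. (\<Sum>x\<in>X. c x / B x * E k x) * cnj (\<Sum>x\<in>X. c x / B x * E k x))"
proof -
  define d where "d x = c x / B x" for x
  have kernel: "c x * cnj (c y) * pick_kernel f x y =
      d x * cnj (d y) * pick_kernel S x y - (\<Sum>k<q. d x * E k x * cnj (d y * E k y))"
    if "x \<in> X" "y \<in> X" for x y
  proof -
    have "B x * cnj (B y) * pick_kernel f x y = pick_kernel S x y - pick_kernel B x y"
      using f[OF that(1)] f[OF that(2)] unfolding pick_kernel_def
      by (simp add: diff_divide_distrib[symmetric] algebra_simps)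
    moreover have "c x * cnj (c y) = d x * cnj (d y) * (B x * cnj (B y))"
      using f[OF that(1)] f[OF that(2)] by (simp add: d_def)
    ultimately have "c x * cnj (c y) * pick_kernel f x y =
        d x * cnj (d y) * (pick_kernel S x y - pick_kernel B x y)" by (simp only: mult.assoc)
    also have "pick_kernel B x y = (\<Sum>k<q. E k x * cnj (E k y))" using E that X by blast
    finally show ?thesis by (simp add: right_diff_distrib sum_distrib_left mult_ac)
  qed
  have "(\<Sum>x\<in>X. \<Sum>y\<in>X. \<Sum>k<q. d x * E k x * cnj (d y * E k y)) =
      (\<Sum>x\<in>X. \<Sum>k<q. \<Sum>y\<in>X. d x * E k x * cnj (d y * E k y))"
    by (intro sum.cong refl sum.swap)
  also have "\<dots> = (\<Sum>k<q. (\<Sum>x\<in>X. d x * E k x) * cnj (\<Sum>x\<in>X. d x * E k x))"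
    unfolding cnj_sum sum_product by (rule sum.swap)
  finally have squares: "(\<Sum>x\<in>X. \<Sum>y\<in>X. \<Sum>k<q. d x * E k x * cnj (d y * E k y)) =
      (\<Sum>k<q. (\<Sum>x\<in>X. d x * E k x) * cnj (\<Sum>x\<in>X. d x * E k x))" .
  have "pick_form f X c =
      (\<Sum>x\<in>X. \<Sum>y\<in>X. d x * cnj (d y) * pick_kernel S x y - (\<Sum>k<q. d x * E k x * cnj (d y * E k y)))"
    unfolding pick_form_def by (intro sum.cong refl kernel)
  then show ?thesis
    unfolding d_def[symmetric] by (simp only: sum_subtractf squares pick_form_def)
qed

lemma sq_neg_pick_matrix_quotient_le:
  assumes zs: "distinct zs" "set zs \<subseteq> disc" and S: "schur_function S" and B: "pick_kernel_rank_le B q"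
    and f: "\<And>x. x \<in> set zs - Zs \<Longrightarrow> B x \<noteq> 0 \<and> f x = S x / B x"
  shows "sq_neg (pick_matrix f zs) \<le> q + card (set zs \<inter> Zs)"
proof -
  obtain E where E: "\<And>z w. z \<in> disc \<Longrightarrow> w \<in> disc \<Longrightarrow> pick_kernel B z w = (\<Sum>k<q. E k z * cnj (E k w))"
    using B unfolding pick_kernel_rank_le_def by blast
  define J where "J = set zs \<inter> Zs"
  define Y where "Y = set zs - Zs"
  have "finite J" "finite Y" "Y \<subseteq> disc" using zs by (auto simp: J_def Y_def)
  define \<phi> where "\<phi> = case_sum (\<lambda>a x. if x = a then 1 else 0) (\<lambda>k x. if x \<in> Zs then 0 else E k x / B x)"
  have "sq_neg (pick_matrix f zs) \<le> card (J <+> {..<q})"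
  proof (rule sq_neg_pick_matrix_le_card_equations[where \<phi> = \<phi>, OF zs(1)])
    fix c assume c: "\<And>m. m \<in> J <+> {..<q} \<Longrightarrow> (\<Sum>x\<in>set zs. c x * \<phi> m x) = 0"
    have "c a = 0" if "a \<in> J" for a
      using c[OF InlI[OF that]] that
      by (simp add: \<phi>_def J_def if_distrib cong: if_cong)
    then have "pick_form f (set zs) c = pick_form f Y c"
      unfolding pick_form_def J_def Y_def
      by (intro sum.mono_neutral_cong_right ballI sum.neutral) auto
    moreover have "(\<Sum>x\<in>Y. c x / B x * E k x) = 0" if "k < q" for k
    proof -
      have "(\<Sum>x\<in>Y. c x / B x * E k x) = (\<Sum>x\<in>set zs. c x * \<phi> (Inr k) x)"
        by (intro sum.mono_neutral_cong_left) (auto simp: Y_def \<phi>_def)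
      then show ?thesis using c[OF InrI, of k] that by simp
    qed
    moreover have "pick_form f Y c = pick_form S Y (\<lambda>x. c x / B x) -
        (\<Sum>k<q. (\<Sum>x\<in>Y. c x / B x * E k x) * cnj (\<Sum>x\<in>Y. c x / B x * E k x))"
      using f by (intro pick_form_quotient \<open>Y \<subseteq> disc\<close> E) (auto simp: Y_def)
    ultimately show "0 \<le> Re (pick_form f (set zs) c)"
      using schur_pick_form_nonneg[OF S \<open>finite Y\<close> \<open>Y \<subseteq> disc\<close>] by simp
  qed (use \<open>finite J\<close> in simp)
  then show ?thesis using \<open>finite J\<close> by (simp add: card_Plus J_def)
qed

section \<open>Approximation of Taylor coefficients by point evaluations\<close>

lemma degree_less_of_degree_linear_mult_le:
  fixes p :: "'a::idom poly"
  assumes "degree ([:a, 1:] * p) \<le> n" "0 < n"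
  shows "degree p < n"
proof (cases "p = 0")
  case False
  have "degree ([:a, 1:] * p) = degree [:a, 1:] + degree p" using False by (intro degree_mult_eq) simp_all
  then show ?thesis using assms by simp
qed (use assms in simp)

lemma fraction_split_simple_pole:
  fixes p q :: "'a::field poly"
  assumes "poly q w \<noteq> 0" "degree p \<le> degree q" "0 < degree q"
  obtains c p' where "degree p' < degree q" "\<forall>z. z \<noteq> w \<longrightarrow> poly q z \<noteq> 0 \<longrightarrow>
    poly p z / ((z - w) * poly q z) = c / (z - w) + poly p' z / poly q z"
proof -
  define c where "c = poly p w / poly q w"
  have "poly (p - Polynomial.smult c q) w = 0" using assms(1) by (simp add: c_def)
  then obtain p' where p': "p - Polynomial.smult c q = [:- w, 1:] * p'"
    by (metis poly_eq_0_iff_dvd dvdE)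
  have "degree (p - Polynomial.smult c q) \<le> degree q" using assms(2) by (intro degree_diff_le) auto
  then have "degree p' < degree q"
    unfolding p' by (rule degree_less_of_degree_linear_mult_le) (rule assms(3))
  moreover have "poly p z / ((z - w) * poly q z) = c / (z - w) + poly p' z / poly q z"
    if "z \<noteq> w" "poly q z \<noteq> 0" for z
  proof -
    have "poly p z = c * poly q z + (z - w) * poly p' z"
      using arg_cong[OF p', of "\<lambda>r. poly r z"] by (simp add: algebra_simps)
    then show ?thesis using that by (simp add: field_simps)
  qed
  ultimately show ?thesis using that by blast
qed

lemma partial_fractions_simple_roots:
  fixes p :: "'a::field poly"
  assumes "finite W" "degree p < card W"
  obtains d where "\<And>z. z \<notin> W \<Longrightarrow> poly p z / (\<Prod>w\<in>W. z - w) = (\<Sum>w\<in>W. d w / (z - w))"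
proof -
  have "W \<noteq> {}" using assms by auto
  have "\<exists>d. \<forall>z. z \<notin> W \<longrightarrow> poly p z / (\<Prod>w\<in>W. z - w) = (\<Sum>w\<in>W. d w / (z - w))"
    using \<open>finite W\<close> \<open>W \<noteq> {}\<close> assms(2)
  proof (induction W arbitrary: p rule: finite_ne_induct)
    case (singleton w)
    then obtain c where "p = [:c:]" by (auto elim: degree_eq_zeroE)
    then show ?case by (intro exI[of _ "\<lambda>_. c"]) simp
  next
    case (insert w W)
    define q where "q = (\<Prod>v\<in>W. [:- v, 1:])"
    have q: "poly q z = (\<Prod>v\<in>W. z - v)" "degree q = card W" for z
      by (simp_all add: q_def poly_prod degree_prod_eq_sum_degree)
    have "poly q w \<noteq> 0" "degree p \<le> degree q" "0 < degree q"
      using insert.hyps insert.prems by (auto simp: q card_gt_0_iff)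
    then obtain c p' where p': "degree p' < degree q" "\<forall>z. z \<noteq> w \<longrightarrow> poly q z \<noteq> 0 \<longrightarrow>
        poly p z / ((z - w) * poly q z) = c / (z - w) + poly p' z / poly q z"
      by (rule fraction_split_simple_pole)
    obtain d where d: "\<forall>z. z \<notin> W \<longrightarrow> poly p' z / (\<Prod>v\<in>W. z - v) = (\<Sum>v\<in>W. d v / (z - v))"
      using insert.IH[of p'] p'(1) q(2) by auto
    have "poly p z / (\<Prod>v\<in>insert w W. z - v) = (\<Sum>v\<in>insert w W. (d(w := c)) v / (z - v))"
      if "z \<notin> insert w W" for z
    proof -
      have "poly q z \<noteq> 0" "z \<noteq> w" using that insert.hyps by (auto simp: q)
      then have "poly p z / (\<Prod>v\<in>insert w W. z - v) = c / (z - w) + (\<Sum>v\<in>W. d v / (z - v))"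
        using p'(2) d that insert.hyps by (simp add: q)
      also have "(\<Sum>v\<in>W. d v / (z - v)) = (\<Sum>v\<in>W. (d(w := c)) v / (z - v))"
        using insert.hyps(3) by (intro sum.cong) auto
      finally show ?thesis using insert.hyps by simp
    qed
    then show ?case by blast
  qed
  then show ?thesis using that by blast
qed

definition simple_pole_approximable :: "real \<Rightarrow> complex set \<Rightarrow> (complex \<Rightarrow> complex) \<Rightarrow> bool" where
  "simple_pole_approximable R \<Omega> h \<longleftrightarrow> (\<forall>\<epsilon>>0. \<forall>T. finite T \<longrightarrow> (\<exists>W p. finite W \<and> W \<subseteq> \<Omega> - T \<and>
     degree p < card W \<and> (\<forall>z. cmod z = R \<longrightarrow> cmod (h z - poly p z / (\<Prod>w\<in>W. z - w)) \<le> \<epsilon>)))"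

lemma simple_pole_approximableE:
  assumes "simple_pole_approximable R \<Omega> h" "\<epsilon> > 0" "finite T"
  obtains W p where "finite W" "W \<subseteq> \<Omega> - T" "degree p < card W"
    "\<forall>z. cmod z = R \<longrightarrow> cmod (h z - poly p z / (\<Prod>w\<in>W. z - w)) \<le> \<epsilon>"
  using assms unfolding simple_pole_approximable_def by metis

lemma moebius_uniformly_less_1:
  assumes "cmod a < R" "\<rho> < R"
  obtains \<theta> where "0 \<le> \<theta>" "\<theta> < 1"
    "\<And>w. cmod w \<le> \<rho> \<Longrightarrow> cmod (Moebius_function 0 (w / of_real R) (a / of_real R)) \<le> \<theta>"
proof (cases "\<rho> < 0")
  case True
  then have "\<not> cmod w \<le> \<rho>" for w by (meson norm_ge_zero not_less order_trans)
  then show ?thesis using that[of 0] by simp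
next
  case False
  have "R > 0" using assms(1) norm_ge_zero[of a] by linarith
  have unit: "cmod (w / of_real R) < 1" if "cmod w < R" for w
    using that \<open>R > 0\<close> by (simp add: norm_divide)
  define \<phi> where "\<phi> = (\<lambda>w. cmod (Moebius_function 0 (w / of_real R) (a / of_real R)))"
  have less_1: "\<phi> w < 1" if "w \<in> cball 0 \<rho>" for w
    unfolding \<phi>_def using that assms by (intro Moebius_function_norm_lt_1 unit) auto
  have "cnj (w / of_real R) * (a / of_real R) \<noteq> 1" if "w \<in> cball 0 \<rho>" for w
  proof -
    have "cmod (cnj (w / of_real R) * (a / of_real R)) < 1 * 1"
      unfolding norm_mult complex_mod_cnj using that assms
      by (intro mult_strict_mono unit) auto
    then show ?thesis by auto
  qed
  then have "continuous_on (cball 0 \<rho>) \<phi>"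
    unfolding \<phi>_def Moebius_function_simple using \<open>R > 0\<close> by (intro continuous_intros) auto
  moreover have "cball 0 \<rho> \<noteq> ({} :: complex set)" using False by simp
  ultimately obtain w\<^sub>0 where "w\<^sub>0 \<in> cball 0 \<rho>" "\<forall>w\<in>cball 0 \<rho>. \<phi> w \<le> \<phi> w\<^sub>0"
    using continuous_attains_sup[OF compact_cball] by blast
  then show ?thesis using that[of "\<phi> w\<^sub>0"] less_1[of w\<^sub>0] by (simp add: \<phi>_def)
qed

lemma Moebius_function_scaled_mult:
  assumes "cmod a < R" "cmod w < R"
  shows "Moebius_function 0 (w / of_real R) (a / of_real R) * (of_real R - cnj w * a / of_real R) = a - w"
proof -
  have "R > 0" using assms(1) norm_ge_zero[of a] by linarith
  have "cmod (cnj w * a) < R * R"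
    unfolding norm_mult complex_mod_cnj using assms \<open>R > 0\<close> by (intro mult_strict_mono) auto
  also have "\<dots> = cmod (of_real R * of_real R)" using \<open>R > 0\<close> by (simp add: norm_mult)
  finally have "of_real R * of_real R - cnj w * a \<noteq> 0" by auto
  moreover have "Moebius_function 0 (w / of_real R) (a / of_real R) =
      of_real R * (a - w) / (of_real R * of_real R - cnj w * a)"
    using \<open>R > 0\<close> by (simp add: Moebius_function_simple divide_simps)
  ultimately show ?thesis using \<open>R > 0\<close> by (simp add: divide_simps)
qed

text \<open>The product \<open>E\<close> over \<open>w \<in> W\<close> of the quotients \<open>b\<^sub>w(a) / b\<^sub>w(z)\<close> of Blaschke factors of the disc
  of radius \<open>R\<close> has its poles in \<open>W\<close>, equals 1 at \<open>a\<close> and has modulus \<open>\<Prod>w\<in>W. |b\<^sub>w(a)|\<close> on the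
  circle of radius \<open>R\<close>. The approximation is \<open>(1 - E z) / (z - a)\<close>, which has no pole at \<open>a\<close>.\<close>
lemma cauchy_kernel_interpolation:
  assumes a: "cmod a < R" and W: "finite W" "\<And>w. w \<in> W \<Longrightarrow> cmod w < R" "W \<noteq> {}"
  obtains p where "degree p < card W" "\<And>z. cmod z = R \<Longrightarrow>
    cmod (1 / (z - a) - poly p z / (\<Prod>w\<in>W. z - w)) =
      (\<Prod>w\<in>W. cmod (Moebius_function 0 (w / of_real R) (a / of_real R))) / cmod (z - a)"
proof -
  have "R > 0" using a norm_ge_zero[of a] by linarith
  define \<mu> where "\<mu> = (\<lambda>w. Moebius_function 0 (w / of_real R) (a / of_real R))"
  define num where "num = (\<Prod>w\<in>W. Polynomial.smult (\<mu> w) [:of_real R, - cnj w / of_real R:])"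
  define den where "den = (\<Prod>w\<in>W. [:- w, 1:])"
  have num: "poly num z = (\<Prod>w\<in>W. \<mu> w * (of_real R - cnj w * z / of_real R))" for z
    by (simp add: num_def poly_prod algebra_simps)
  have den: "poly den z = (\<Prod>w\<in>W. z - w)" for z by (simp add: den_def poly_prod)
  have "\<mu> w * (of_real R - cnj w * a / of_real R) = a - w" if "w \<in> W" for w
    unfolding \<mu>_def using a W(2)[OF that] by (rule Moebius_function_scaled_mult)
  then have "poly (den - num) a = 0" by (simp add: num den)
  then obtain p where p: "den - num = [:- a, 1:] * p" by (metis poly_eq_0_iff_dvd dvdE)
  have degree_sum: "(\<Sum>w\<in>W. degree (Polynomial.smult (\<mu> w) [:of_real R, - cnj w / of_real R:])) \<le> (\<Sum>w\<in>W. 1)"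
    by (intro sum_mono) auto
  have "degree num \<le> card W"
    unfolding num_def using degree_prod_sum_le[OF W(1)] degree_sum by (force intro: order_trans)
  moreover have "degree den = card W" by (simp add: den_def degree_prod_eq_sum_degree)
  ultimately have "degree (den - num) \<le> card W" by (intro degree_diff_le) auto
  then have "degree p < card W"
    unfolding p by (rule degree_less_of_degree_linear_mult_le) (simp add: W card_gt_0_iff)
  moreover have "cmod (1 / (z - a) - poly p z / (\<Prod>w\<in>W. z - w)) = (\<Prod>w\<in>W. cmod (\<mu> w)) / cmod (z - a)"
    if z: "cmod z = R" for z
  proof -
    have "z \<noteq> a" "z \<notin> W" using a W(2) z by auto
    then have "poly den z \<noteq> 0" using W(1) by (simp add: den)
    have "(z - a) * poly p z = poly den z - poly num z"
      using arg_cong[OF p, of "\<lambda>r. poly r z"] by (simp add: algebra_simps)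
    then have "1 / (z - a) - poly p z / poly den z = poly num z / poly den z / (z - a)"
      using \<open>poly den z \<noteq> 0\<close> \<open>z \<noteq> a\<close> by (simp add: field_simps)
    moreover have "cmod (poly num z) = (\<Prod>w\<in>W. cmod (\<mu> w)) * cmod (poly den z)"
      by (simp add: num den norm_mult prod_norm[symmetric] prod.distrib norm_circle_reflection[OF z \<open>R > 0\<close>])
    ultimately show ?thesis using \<open>poly den z \<noteq> 0\<close> by (simp add: norm_divide norm_mult den)
  qed
  ultimately show ?thesis using that by (simp add: \<mu>_def)
qed

lemma simple_pole_approximable_cauchy_kernel:
  assumes \<Omega>: "infinite \<Omega>" "\<Omega> \<subseteq> cball 0 \<rho>" "\<rho> < R" and a: "cmod a < R"
  shows "simple_pole_approximable R \<Omega> (\<lambda>z. 1 / (z - a))"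
  unfolding simple_pole_approximable_def
proof (intro allI impI)
  fix \<epsilon> :: real and T :: "complex set" assume "\<epsilon> > 0" "finite T"
  define \<delta> where "\<delta> = R - cmod a"
  have "\<delta> > 0" using a by (simp add: \<delta>_def)
  obtain \<theta> where \<theta>: "0 \<le> \<theta>" "\<theta> < 1"
    "\<And>w. cmod w \<le> \<rho> \<Longrightarrow> cmod (Moebius_function 0 (w / of_real R) (a / of_real R)) \<le> \<theta>"
    using moebius_uniformly_less_1[OF a \<Omega>(3)] by metis
  obtain n where n: "\<theta> ^ n < \<epsilon> * \<delta>"
    using real_arch_pow_inv[OF _ \<theta>(2)] \<open>\<epsilon> > 0\<close> \<open>\<delta> > 0\<close> by (meson mult_pos_pos)
  have "infinite (\<Omega> - T)" using \<Omega>(1) \<open>finite T\<close> by simp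
  then obtain W where W: "finite W" "card W = Suc n" "W \<subseteq> \<Omega> - T"
    using infinite_arbitrarily_large by blast
  then have norm_W: "cmod w \<le> \<rho>" if "w \<in> W" for w using that \<Omega>(2) by auto
  have "W \<noteq> {}" "\<And>w. w \<in> W \<Longrightarrow> cmod w < R" using W(2) norm_W \<Omega>(3) by fastforce+
  then obtain p where p: "degree p < card W" "\<And>z. cmod z = R \<Longrightarrow>
      cmod (1 / (z - a) - poly p z / (\<Prod>w\<in>W. z - w)) =
        (\<Prod>w\<in>W. cmod (Moebius_function 0 (w / of_real R) (a / of_real R))) / cmod (z - a)"
    using cauchy_kernel_interpolation[OF a W(1)] by metis
  have "cmod (1 / (z - a) - poly p z / (\<Prod>w\<in>W. z - w)) \<le> \<epsilon>" if z: "cmod z = R" for z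
  proof -
    have "(\<Prod>w\<in>W. cmod (Moebius_function 0 (w / of_real R) (a / of_real R))) \<le> (\<Prod>w\<in>W. \<theta>)"
      using \<theta>(3) norm_W by (intro prod_mono) auto
    also have "\<dots> \<le> \<theta> ^ n" using \<theta> W(2) by (simp add: mult_left_le_one_le)
    finally have "cmod (1 / (z - a) - poly p z / (\<Prod>w\<in>W. z - w)) \<le> \<epsilon> * \<delta> / cmod (z - a)"
      unfolding p(2)[OF z] using n by (intro divide_right_mono) auto
    also have "\<dots> \<le> \<epsilon> * \<delta> / \<delta>"
      using norm_triangle_ineq2[of z a] z \<open>\<delta> > 0\<close> \<open>\<epsilon> > 0\<close> by (intro frac_le) (auto simp: \<delta>_def)
    finally show ?thesis using \<open>\<delta> > 0\<close> by simp
  qed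
  then show "\<exists>W p. finite W \<and> W \<subseteq> \<Omega> - T \<and> degree p < card W \<and>
      (\<forall>z. cmod z = R \<longrightarrow> cmod (1 / (z - a) - poly p z / (\<Prod>w\<in>W. z - w)) \<le> \<epsilon>)"
    using W p(1) by blast
qed

lemma simple_pole_approximable_mult:
  assumes g: "simple_pole_approximable R \<Omega> g" "\<And>z. cmod z = R \<Longrightarrow> cmod (g z) \<le> C" and "C > 0"
    and h: "simple_pole_approximable R \<Omega> h" "\<And>z. cmod z = R \<Longrightarrow> cmod (h z) \<le> C'" and "C' > 0"
  shows "simple_pole_approximable R \<Omega> (\<lambda>z. g z * h z)"
  unfolding simple_pole_approximable_def
proof (intro allI impI)
  fix \<epsilon> :: real and T :: "complex set" assume "\<epsilon> > 0" "finite T"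
  define \<delta> where "\<delta> = min 1 (\<epsilon> / (2 * C))"
  have \<delta>: "\<delta> > 0" "\<delta> \<le> 1" "C * \<delta> \<le> \<epsilon> / 2"
    using \<open>\<epsilon> > 0\<close> \<open>C > 0\<close> by (auto simp: \<delta>_def min_def field_simps)
  obtain W' p' where W': "finite W'" "W' \<subseteq> \<Omega> - T" "degree p' < card W'"
    "\<forall>z. cmod z = R \<longrightarrow> cmod (h z - poly p' z / (\<Prod>w\<in>W'. z - w)) \<le> \<delta>"
    using simple_pole_approximableE[OF h(1) \<open>\<delta> > 0\<close> \<open>finite T\<close>] .
  have "\<epsilon> / (2 * (C' + 1)) > 0" "finite (T \<union> W')" using \<open>\<epsilon> > 0\<close> \<open>C' > 0\<close> \<open>finite T\<close> W'(1) by auto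
  then obtain W p where W: "finite W" "W \<subseteq> \<Omega> - (T \<union> W')" "degree p < card W"
    "\<forall>z. cmod z = R \<longrightarrow> cmod (g z - poly p z / (\<Prod>w\<in>W. z - w)) \<le> \<epsilon> / (2 * (C' + 1))"
    using simple_pole_approximableE[OF g(1)] by metis
  have "W \<inter> W' = {}" using W(2) by blast
  have "cmod (g z * h z - poly (p * p') z / (\<Prod>w\<in>W \<union> W'. z - w)) \<le> \<epsilon>" if z: "cmod z = R" for z
  proof -
    define u where "u = poly p z / (\<Prod>w\<in>W. z - w)"
    define v where "v = poly p' z / (\<Prod>w\<in>W'. z - w)"
    have "cmod (h z - v) \<le> \<delta>" using W'(4) z by (simp add: v_def)
    then have "cmod v \<le> C' + 1" using h(2)[OF z] \<delta>(2) norm_triangle_ineq3[of v "h z"]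
      by (simp add: norm_minus_commute)
    have "poly (p * p') z / (\<Prod>w\<in>W \<union> W'. z - w) = u * v"
      using W(1) W'(1) \<open>W \<inter> W' = {}\<close> by (simp add: u_def v_def prod.union_disjoint)
    then have "g z * h z - poly (p * p') z / (\<Prod>w\<in>W \<union> W'. z - w) = g z * (h z - v) + (g z - u) * v"
      by (simp add: algebra_simps)
    also have "cmod \<dots> \<le> cmod (g z) * cmod (h z - v) + cmod (g z - u) * cmod v"
      by (metis norm_mult norm_triangle_ineq)
    also have "\<dots> \<le> C * \<delta> + \<epsilon> / (2 * (C' + 1)) * (C' + 1)"
      using g(2)[OF z] \<open>cmod (h z - v) \<le> \<delta>\<close> W(4) z \<open>cmod v \<le> C' + 1\<close> \<open>C > 0\<close> \<open>C' > 0\<close> \<open>\<epsilon> > 0\<close>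
      by (intro add_mono mult_mono) (auto simp: u_def)
    also have "\<epsilon> / (2 * (C' + 1)) * (C' + 1) = \<epsilon> / 2" using \<open>C' > 0\<close> by (simp add: field_simps)
    also have "C * \<delta> + \<epsilon> / 2 \<le> \<epsilon>" using \<delta>(3) by simp
    finally show ?thesis .
  qed
  moreover have "degree (p * p') < card (W \<union> W')"
    using degree_mult_le[of p p'] W(1,3) W'(1,3) \<open>W \<inter> W' = {}\<close> by (simp add: card_Un_disjoint)
  ultimately show "\<exists>W p. finite W \<and> W \<subseteq> \<Omega> - T \<and> degree p < card W \<and>
      (\<forall>z. cmod z = R \<longrightarrow> cmod (g z * h z - poly p z / (\<Prod>w\<in>W. z - w)) \<le> \<epsilon>)"
    using W(1,2) W'(1,2) by (intro exI[of _ "W \<union> W'"] exI[of _ "p * p'"]) auto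
qed

lemma simple_pole_approximable_cauchy_kernel_power:
  assumes \<Omega>: "infinite \<Omega>" "\<Omega> \<subseteq> cball 0 \<rho>" "\<rho> < R" and a: "cmod a < R"
  shows "simple_pole_approximable R \<Omega> (\<lambda>z. (1 / (z - a)) ^ Suc i)"
proof (induction i)
  case 0
  show ?case using simple_pole_approximable_cauchy_kernel[OF assms] by simp
next
  case (Suc i)
  define \<delta> where "\<delta> = R - cmod a"
  have "\<delta> > 0" using a by (simp add: \<delta>_def)
  have bound: "cmod (1 / (z - a)) \<le> 1 / \<delta>" if "cmod z = R" for z
    using norm_triangle_ineq2[of z a] that \<open>\<delta> > 0\<close> unfolding norm_divide norm_one
    by (intro frac_le) (auto simp: \<delta>_def)
  have "simple_pole_approximable R \<Omega> (\<lambda>z. 1 / (z - a) * (1 / (z - a)) ^ Suc i)"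
  proof (rule simple_pole_approximable_mult[OF _ bound _ Suc])
    show "cmod ((1 / (z - a)) ^ Suc i) \<le> (1 / \<delta>) ^ Suc i" if "cmod z = R" for z
      unfolding norm_power using bound[OF that] by (intro power_mono) auto
  qed (use \<open>\<delta> > 0\<close> simple_pole_approximable_cauchy_kernel[OF assms] in simp_all)
  then show ?case by simp
qed

lemma has_contour_integral_fps_expansion:
  assumes "continuous_on (cball 0 R) F" "F holomorphic_on ball 0 R" "cmod a < R"
  shows "((\<lambda>z. F z * (1 / (z - a)) ^ Suc i) has_contour_integral
    2 * of_real pi * \<i> * fps_nth (fps_expansion F a) i) (circlepath 0 R)"
  using Cauchy_has_contour_integral_higher_derivative_circlepath[OF assms(1,2), of a i] assms(3)
  by (simp add: fps_expansion_def power_divide)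

lemma taylor_coefficient_cauchy_kernel_error:
  assumes F: "continuous_on (cball 0 R) F" "F holomorphic_on ball 0 R"
    and C: "\<And>z. cmod z = R \<Longrightarrow> cmod (F z) \<le> C" and a: "cmod a < R" and W: "finite W" "W \<subseteq> ball 0 R"
    and error: "\<And>z. cmod z = R \<Longrightarrow> cmod ((1 / (z - a)) ^ Suc i - (\<Sum>w\<in>W. d w / (z - w))) \<le> \<epsilon>"
  shows "cmod (fps_nth (fps_expansion F a) i - (\<Sum>w\<in>W. d w * F w)) \<le> \<epsilon> * C * R"
proof -
  have "R > 0" using a norm_ge_zero[of a] by linarith
  then have "0 \<le> C" "0 \<le> \<epsilon>"
    using order_trans[OF norm_ge_zero C[of "of_real R"]] order_trans[OF norm_ge_zero error[of "of_real R"]]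
    by simp_all
  define D where "D = fps_nth (fps_expansion F a) i - (\<Sum>w\<in>W. d w * F w)"
  define G where "G = (\<lambda>z. F z * (1 / (z - a)) ^ Suc i - (\<Sum>w\<in>W. d w * (F z / (z - w))))"
  have "((\<lambda>z. F z / (z - w)) has_contour_integral 2 * of_real pi * \<i> * F w) (circlepath 0 R)"
    if "w \<in> W" for w
    using has_contour_integral_fps_expansion[OF F, of w 0] W(2) that by (auto simp: fps_expansion_def)
  then have "(G has_contour_integral 2 * of_real pi * \<i> * fps_nth (fps_expansion F a) i -
      (\<Sum>w\<in>W. d w * (2 * of_real pi * \<i> * F w))) (circlepath 0 R)"
    unfolding G_def using W(1)
    by (intro has_contour_integral_diff has_contour_integral_sum has_contour_integral_lmul
        has_contour_integral_fps_expansion F a) auto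
  also have "2 * of_real pi * \<i> * fps_nth (fps_expansion F a) i -
      (\<Sum>w\<in>W. d w * (2 * of_real pi * \<i> * F w)) = 2 * of_real pi * \<i> * D"
    unfolding D_def right_diff_distrib sum_distrib_left by (simp add: mult_ac)
  finally have int: "(G has_contour_integral 2 * of_real pi * \<i> * D) (circlepath 0 R)" .
  have "cmod (2 * of_real pi * \<i> * D) \<le> \<epsilon> * C * (2 * pi * R)"
  proof (rule has_contour_integral_bound_circlepath[OF int])
    fix z :: complex assume "cmod (z - 0) = R"
    then have z: "cmod z = R" by simp
    have "G z = ((1 / (z - a)) ^ Suc i - (\<Sum>w\<in>W. d w / (z - w))) * F z"
      unfolding G_def left_diff_distrib sum_distrib_right by (simp add: mult.commute)
    then have "cmod (G z) = cmod ((1 / (z - a)) ^ Suc i - (\<Sum>w\<in>W. d w / (z - w))) * cmod (F z)"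
      by (simp only: norm_mult)
    also have "\<dots> \<le> \<epsilon> * C" using error[OF z] C[OF z] \<open>0 \<le> \<epsilon>\<close> by (intro mult_mono) auto
    finally show "cmod (G z) \<le> \<epsilon> * C" .
  qed (use \<open>R > 0\<close> \<open>0 \<le> \<epsilon>\<close> \<open>0 \<le> C\<close> in auto)
  then have "2 * pi * cmod D \<le> 2 * pi * (\<epsilon> * C * R)" by (simp add: norm_mult mult_ac)
  then show ?thesis by (simp add: D_def)
qed

lemma holomorphic_bounded_on_circle:
  assumes "F holomorphic_on cball 0 R"
  obtains C where "C > 0" "\<And>z. cmod z = R \<Longrightarrow> cmod (F z) \<le> C"
proof -
  have "F holomorphic_on sphere 0 R" using assms by (rule holomorphic_on_subset) auto
  then have "compact (F ` sphere 0 R)"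
    by (intro compact_continuous_image holomorphic_on_imp_continuous_on compact_sphere)
  then obtain C where "C > 0" "\<forall>w\<in>F ` sphere 0 R. cmod w \<le> C"
    using compact_imp_bounded bounded_pos by metis
  then show ?thesis using that[of C] by simp
qed

lemma taylor_coefficient_moments_approximable:
  assumes \<Omega>: "infinite \<Omega>" "\<Omega> \<subseteq> cball 0 \<rho>" "\<rho> < R" and a: "cmod a < R" and "\<epsilon> > 0" "finite T"
    and \<F>: "finite \<F>" "\<And>F. F \<in> \<F> \<Longrightarrow> F holomorphic_on cball 0 R"
  obtains W d where "finite W" "W \<subseteq> \<Omega> - T" "\<forall>F\<in>\<F>. \<forall>m.
    cmod (fps_nth (fps_expansion (\<lambda>z. z ^ m * F z) a) i - (\<Sum>w\<in>W. d w * (w ^ m * F w))) \<le> \<epsilon> * R ^ m"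
proof -
  have "R > 0" using a norm_ge_zero[of a] by linarith
  have "\<forall>F\<in>\<F>. \<exists>C>0. \<forall>z. cmod z = R \<longrightarrow> cmod (F z) \<le> C"
    using holomorphic_bounded_on_circle \<F>(2) by metis
  then obtain C where C: "\<And>F. F \<in> \<F> \<Longrightarrow> C F > 0" "\<And>F z. F \<in> \<F> \<Longrightarrow> cmod z = R \<Longrightarrow> cmod (F z) \<le> C F"
    by metis
  define M where "M = 1 + (\<Sum>F\<in>\<F>. C F)"
  have "M > 0" unfolding M_def using C(1) by (intro add_pos_nonneg sum_nonneg) (auto intro: less_imp_le)
  have M: "C F \<le> M" if "F \<in> \<F>" for F
    using member_le_sum[OF that, of C] \<F>(1) C(1) by (force simp: M_def intro: less_imp_le)
  define \<delta> where "\<delta> = \<epsilon> / (M * R)"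
  have "\<delta> > 0" using \<open>\<epsilon> > 0\<close> \<open>M > 0\<close> \<open>R > 0\<close> by (simp add: \<delta>_def)
  obtain W p where W: "finite W" "W \<subseteq> \<Omega> - T" "degree p < card W"
    "\<forall>z. cmod z = R \<longrightarrow> cmod ((1 / (z - a)) ^ Suc i - poly p z / (\<Prod>w\<in>W. z - w)) \<le> \<delta>"
    using simple_pole_approximableE[OF simple_pole_approximable_cauchy_kernel_power[OF \<Omega> a]
        \<open>\<delta> > 0\<close> \<open>finite T\<close>] .
  obtain d where d: "\<And>z. z \<notin> W \<Longrightarrow> poly p z / (\<Prod>w\<in>W. z - w) = (\<Sum>w\<in>W. d w / (z - w))"
    using partial_fractions_simple_roots[OF W(1,3)] by metis
  have norm_W: "W \<subseteq> ball 0 R" using W(2) \<Omega>(2,3) by fastforce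
  have "cmod (fps_nth (fps_expansion (\<lambda>z. z ^ m * F z) a) i - (\<Sum>w\<in>W. d w * (w ^ m * F w))) \<le> \<epsilon> * R ^ m"
    if F: "F \<in> \<F>" for F m
  proof -
    have hol: "(\<lambda>z. z ^ m * F z) holomorphic_on cball 0 R" using \<F>(2)[OF F] by (intro holomorphic_intros)
    have "cmod (fps_nth (fps_expansion (\<lambda>z. z ^ m * F z) a) i - (\<Sum>w\<in>W. d w * (w ^ m * F w)))
        \<le> \<delta> * (R ^ m * M) * R"
    proof (rule taylor_coefficient_cauchy_kernel_error[OF _ _ _ a W(1) norm_W])
      show "(\<lambda>z. z ^ m * F z) holomorphic_on ball 0 R" using hol by (rule holomorphic_on_subset) auto
      show "cmod (z ^ m * F z) \<le> R ^ m * M" if "cmod z = R" for z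
        using order_trans[OF C(2)[OF F that] M[OF F]] that \<open>R > 0\<close>
        by (auto simp: norm_mult norm_power intro!: mult_left_mono)
      show "cmod ((1 / (z - a)) ^ Suc i - (\<Sum>w\<in>W. d w / (z - w))) \<le> \<delta>" if "cmod z = R" for z
      proof -
        have "z \<notin> W" using norm_W that by auto
        then show ?thesis using W(4) that unfolding d[OF \<open>z \<notin> W\<close>, symmetric] by blast
      qed
    qed (rule holomorphic_on_imp_continuous_on[OF hol])
    also have "\<dots> = \<epsilon> * R ^ m" using \<open>M > 0\<close> \<open>R > 0\<close> by (simp add: \<delta>_def)
    finally show ?thesis .
  qed
  then show ?thesis using that[of W d] W(1,2) by blast
qed

section \<open>The lower bound\<close>

lemma poly_analytic_on: "poly (p :: complex poly) analytic_on A"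
  unfolding poly_altdef[abs_def] by (intro analytic_intros)

lemma fps_expansion_mult:
  assumes "f analytic_on {a}" "g analytic_on {a}"
  shows "fps_expansion (\<lambda>z. f z * g z) a = fps_expansion f a * fps_expansion g a"
  using assms by (intro fps_expansion_unique_complex[OF analytic_at_imp_has_fps_expansion]
      has_fps_expansion_mult analytic_at_imp_has_fps_expansion analytic_intros)

lemma fps_expansion_lincomb:
  assumes "\<And>k. k \<in> K \<Longrightarrow> g k analytic_on {a}"
  shows "fps_expansion (\<lambda>z. \<Sum>k\<in>K. c k * g k z) a = (\<Sum>k\<in>K. fps_const (c k) * fps_expansion (g k) a)"
  using assms by (intro fps_expansion_unique_complex[OF analytic_at_imp_has_fps_expansion]
      has_fps_expansion_sum has_fps_expansion_cmult_left analytic_at_imp_has_fps_expansion analytic_intros)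

lemma fps_nth_fps_expansion_mult_vanishing:
  assumes "g analytic_on {a}" "B analytic_on {a}" and "\<And>j. j < i \<Longrightarrow> fps_nth (fps_expansion B a) j = 0"
  shows "fps_nth (fps_expansion (\<lambda>z. g z * B z) a) i = g a * fps_nth (fps_expansion B a) i"
proof -
  have "fps_nth (fps_expansion (\<lambda>z. g z * B z) a) i =
      (\<Sum>j=0..i. fps_nth (fps_expansion g a) j * fps_nth (fps_expansion B a) (i - j))"
    by (simp add: fps_expansion_mult assms fps_mult_nth)
  also have "\<dots> = (\<Sum>j\<in>{0}. fps_nth (fps_expansion g a) j * fps_nth (fps_expansion B a) (i - j))"
    using assms(3) by (intro sum.mono_neutral_right) auto
  finally show ?thesis by (simp add: fps_expansion_def)
qed

lemma fps_nth_fps_expansion_power_mult: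
  assumes "G analytic_on {a}"
  shows "fps_nth (fps_expansion (\<lambda>z. (z - a) ^ k * G z) a) i =
    (if i < k then 0 else fps_nth (fps_expansion G a) (i - k))"
proof -
  have "(\<lambda>x. (a + x - a) ^ k * G (a + x)) has_fps_expansion fps_X ^ k * fps_expansion G a"
    using assms by (auto intro!: has_fps_expansion_mult has_fps_expansion_fps_X_power
        analytic_at_imp_has_fps_expansion)
  moreover have "(\<lambda>z. (z - a) ^ k * G z) analytic_on {a}" using assms by (intro analytic_intros)
  ultimately have "fps_expansion (\<lambda>z. (z - a) ^ k * G z) a = fps_X ^ k * fps_expansion G a"
    using analytic_at_imp_has_fps_expansion fps_expansion_unique_complex by blast
  then show ?thesis by (simp add: fps_X_power_mult_nth)
qed

lemma fps_nth_fps_expansion_less_zorder: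
  assumes "f analytic_on {a}" "int j < zorder f a"
  shows "fps_nth (fps_expansion f a) j = 0"
proof (cases "fps_expansion f a = 0")
  case False
  then have "zorder f a = int (subdegree (fps_expansion f a))"
    using assms(1) by (intro has_fps_expansion_zorder analytic_at_imp_has_fps_expansion)
  then show ?thesis using assms(2) by (intro nth_less_subdegree_zero) simp
qed simp

text \<open>The Taylor functional \<open>q \<mapsto> (q S)^(i)(a) / i!\<close>, corrected by the point mass at \<open>a\<close> which, when
  \<open>i\<close> is at most the order of \<open>B\<close> at \<open>a\<close>, makes it vanish for \<open>S = B\<close> and \<open>f = 1\<close>.\<close>
definition pole_jump_functional ::
  "(complex \<Rightarrow> complex) \<Rightarrow> (complex \<Rightarrow> complex) \<Rightarrow> (complex \<Rightarrow> complex) \<Rightarrow>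
    complex \<times> nat \<Rightarrow> (complex \<Rightarrow> complex) \<Rightarrow> complex" where
  "pole_jump_functional S B f = (\<lambda>(a, i) q.
     fps_nth (fps_expansion (\<lambda>z. q z * S z) a) i - fps_nth (fps_expansion B a) i * f a * q a)"

lemma pole_jump_functional_lincomb:
  assumes S: "S analytic_on {fst \<iota>}" and g: "\<And>k. k \<in> K \<Longrightarrow> g k analytic_on {fst \<iota>}"
  shows "pole_jump_functional S B f \<iota> (\<lambda>z. \<Sum>k\<in>K. c k * g k z) =
    (\<Sum>k\<in>K. c k * pole_jump_functional S B f \<iota> (g k))"
proof -
  obtain a i where \<iota>: "\<iota> = (a, i)" by (cases \<iota>)
  have "fps_expansion (\<lambda>z. (\<Sum>k\<in>K. c k * g k z) * S z) a =
      (\<Sum>k\<in>K. fps_const (c k) * fps_expansion (\<lambda>z. g k z * S z) a)"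
    unfolding sum_distrib_right mult.assoc using S g
    by (intro fps_expansion_lincomb analytic_intros) (auto simp: \<iota>)
  then show ?thesis
    by (simp add: \<iota> pole_jump_functional_def fps_sum_nth right_diff_distrib sum_subtractf
        sum_distrib_left mult_ac)
qed

lemma pole_jump_functional_poly:
  assumes "S analytic_on {fst \<iota>}"
  shows "pole_jump_functional S B f \<iota> (poly q) =
    (\<Sum>m\<le>degree q. coeff q m * pole_jump_functional S B f \<iota> (\<lambda>z. z ^ m))"
  unfolding poly_altdef[abs_def] using assms
  by (intro pole_jump_functional_lincomb analytic_intros)

lemma pole_jump_functional_power_mult:
  assumes "G analytic_on {a}" "S analytic_on {a}"
  shows "i < k \<Longrightarrow> pole_jump_functional S B f (a, i) (\<lambda>z. (z - a) ^ k * G z) = 0"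
    and "pole_jump_functional S B f (a, k) (\<lambda>z. (z - a) ^ k * G z) =
      G a * (if k = 0 then S a - B a * f a else S a)"
  using fps_nth_fps_expansion_power_mult[of "\<lambda>z. G z * S z" a k] assms
  by (auto simp: pole_jump_functional_def mult.assoc fps_expansion_def analytic_intros algebra_simps)

lemma pole_jump_functional_test_polynomial:
  fixes P :: "complex set" and N :: "complex \<Rightarrow> nat"
  assumes P: "finite P" and S: "\<And>a. a \<in> P \<Longrightarrow> S analytic_on {a}"
    and not_quotient: "\<And>a. a \<in> P \<Longrightarrow> S a \<noteq> B a * f a" and pole: "\<And>a. a \<in> P \<Longrightarrow> 1 < N a \<Longrightarrow> B a = 0"
    and a: "a \<in> P" "k < N a"
  obtains q :: "complex poly" where "pole_jump_functional S B f (a, k) (poly q) \<noteq> 0"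
    "\<And>i. i < k \<Longrightarrow> pole_jump_functional S B f (a, i) (poly q) = 0"
    "\<And>a' i. a' \<in> P \<Longrightarrow> a' \<noteq> a \<Longrightarrow> i < N a' \<Longrightarrow> pole_jump_functional S B f (a', i) (poly q) = 0"
proof -
  define q where "q = [:- a, 1:] ^ k * (\<Prod>a'\<in>P - {a}. [:- a', 1:] ^ N a')"
  have other: "pole_jump_functional S B f (a', i) (poly q) = 0" if "a' \<in> P" "a' \<noteq> a" "i < N a'" for a' i
  proof -
    define G where "G = (\<lambda>z. (z - a) ^ k * (\<Prod>a''\<in>P - {a} - {a'}. (z - a'') ^ N a''))"
    have "poly q = (\<lambda>z. (z - a') ^ N a' * G z)"
      using P that by (simp add: fun_eq_iff q_def G_def poly_prod prod.remove[of "P - {a}" a'])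
    moreover have "G analytic_on {a'}" unfolding G_def by (intro analytic_intros)
    ultimately show ?thesis using pole_jump_functional_power_mult(1) S that by simp
  qed
  define H where "H = (\<lambda>z. \<Prod>a'\<in>P - {a}. (z - a') ^ N a')"
  have q: "poly q = (\<lambda>z. (z - a) ^ k * H z)" by (simp add: fun_eq_iff q_def H_def poly_prod)
  have "H analytic_on {a}" unfolding H_def by (intro analytic_intros)
  note power_mult = pole_jump_functional_power_mult[OF this S[OF a(1)]]
  have "H a \<noteq> 0" using P by (simp add: H_def)
  moreover have "S a \<noteq> 0" if "k \<noteq> 0" using not_quotient[OF a(1)] pole[OF a(1)] a(2) that by auto
  ultimately have "pole_jump_functional S B f (a, k) (poly q) \<noteq> 0"
    using not_quotient[OF a(1)] by (simp add: q power_mult(2))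
  moreover have "pole_jump_functional S B f (a, i) (poly q) = 0" if "i < k" for i
    using power_mult(1) that by (simp add: q)
  ultimately show ?thesis using that other by blast
qed

text \<open>Downward recursion on \<open>k\<close>: the test polynomial for \<open>(a, k)\<close> is seen only by the functionals at
  \<open>a\<close> of index at least \<open>k\<close>.\<close>
lemma pole_jump_functional_dual_polynomial:
  fixes P :: "complex set" and N :: "complex \<Rightarrow> nat"
  assumes P: "finite P" and S: "\<And>a. a \<in> P \<Longrightarrow> S analytic_on {a}"
    and not_quotient: "\<And>a. a \<in> P \<Longrightarrow> S a \<noteq> B a * f a" and pole: "\<And>a. a \<in> P \<Longrightarrow> 1 < N a \<Longrightarrow> B a = 0"
    and a: "a \<in> P" "k < N a"
  shows "\<exists>p :: complex poly. \<forall>a'\<in>P. \<forall>i<N a'.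
    pole_jump_functional S B f (a', i) (poly p) = (if a' = a \<and> i = k then 1 else 0)"
  using a(2)
proof (induction "N a - k" arbitrary: k rule: less_induct)
  case less
  define K where "K = {Suc k..<N a}"
  have "\<forall>j\<in>K. \<exists>p. \<forall>a'\<in>P. \<forall>i<N a'.
      pole_jump_functional S B f (a', i) (poly p) = (if a' = a \<and> i = j then 1 else 0)"
    by (intro ballI less.hyps) (auto simp: K_def)
  then obtain p where p: "\<And>j a' i. j \<in> K \<Longrightarrow> a' \<in> P \<Longrightarrow> i < N a' \<Longrightarrow>
      pole_jump_functional S B f (a', i) (poly (p j)) = (if a' = a \<and> i = j then 1 else 0)" by metis
  obtain q where q: "pole_jump_functional S B f (a, k) (poly q) \<noteq> 0"
    "\<And>i. i < k \<Longrightarrow> pole_jump_functional S B f (a, i) (poly q) = 0"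
    "\<And>a' i. a' \<in> P \<Longrightarrow> a' \<noteq> a \<Longrightarrow> i < N a' \<Longrightarrow> pole_jump_functional S B f (a', i) (poly q) = 0"
    using pole_jump_functional_test_polynomial[where S = S and B = B and f = f and N = N,
        OF P S not_quotient pole a(1) less.prems] by metis
  define \<mu> where "\<mu> = (\<lambda>i. pole_jump_functional S B f (a, i) (poly q))"
  define c where "c = (\<lambda>i. (if i = k then 1 else - \<mu> i) / \<mu> k)"
  define g where "g = (\<lambda>i. if i = k then q else p i)"
  define r where "r = (\<Sum>i\<in>insert k K. Polynomial.smult (c i) (g i))"
  have "pole_jump_functional S B f (a', i) (poly r) = (if a' = a \<and> i = k then 1 else 0)"
    if "a' \<in> P" "i < N a'" for a' i
  proof -
    have "poly r = (\<lambda>z. \<Sum>i\<in>insert k K. c i * poly (g i) z)" by (simp add: r_def poly_sum fun_eq_iff)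
    then have "pole_jump_functional S B f (a', i) (poly r) =
        (\<Sum>j\<in>insert k K. c j * pole_jump_functional S B f (a', i) (poly (g j)))"
      using S that by (simp only:) (intro pole_jump_functional_lincomb, auto intro: poly_analytic_on)
    also have "\<dots> = pole_jump_functional S B f (a', i) (poly q) / \<mu> k +
        (\<Sum>j\<in>K. if a' = a \<and> i = j then - \<mu> j / \<mu> k else 0)"
      using p[OF _ that] by (simp add: K_def c_def g_def) (intro sum.cong, auto)
    also have "\<dots> = (if a' = a \<and> i = k then 1 else 0)"
      using q that by (cases "a' = a") (auto simp: \<mu>_def K_def)
    finally show ?thesis .
  qed
  then show ?case by blast
qed

lemma pole_jump_moments_dual_polynomial:
  fixes P :: "complex set" and N :: "complex \<Rightarrow> nat"
  assumes "finite P" and S: "\<And>a. a \<in> P \<Longrightarrow> S analytic_on {a}"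
    and "\<And>a. a \<in> P \<Longrightarrow> S a \<noteq> B a * f a" "\<And>a. a \<in> P \<Longrightarrow> 1 < N a \<Longrightarrow> B a = 0"
    and \<iota>: "\<iota> \<in> Sigma P (\<lambda>a. {..<N a})"
  shows "\<exists>p :: complex poly. \<forall>\<iota>'\<in>Sigma P (\<lambda>a. {..<N a}).
    (\<Sum>m\<le>degree p. coeff p m * pole_jump_functional S B f \<iota>' (\<lambda>z. z ^ m)) = (if \<iota>' = \<iota> then 1 else 0)"
proof -
  obtain a k where ak: "\<iota> = (a, k)" "a \<in> P" "k < N a" using \<iota> by auto
  have "\<exists>p :: complex poly. \<forall>a'\<in>P. \<forall>i<N a'.
      pole_jump_functional S B f (a', i) (poly p) = (if a' = a \<and> i = k then 1 else 0)"
    using assms(1-4) ak(2,3) by (rule pole_jump_functional_dual_polynomial)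
  then obtain p :: "complex poly" where "\<forall>a'\<in>P. \<forall>i<N a'.
      pole_jump_functional S B f (a', i) (poly p) = (if a' = a \<and> i = k then 1 else 0)" ..
  then show ?thesis using S by (intro exI[of _ p]) (auto simp: ak(1) pole_jump_functional_poly[symmetric])
qed

text \<open>In the norm \<open>sup |u m| / R^m\<close>, \<open>v\<close> is a limit of moment sequences \<open>V\<close> of masses on \<open>A\<close> whose
  moment sequences \<open>U\<close> tend to 0.\<close>
definition limit_moments :: "real \<Rightarrow> (complex \<Rightarrow> complex) \<Rightarrow> complex set \<Rightarrow> (nat \<Rightarrow> complex) \<Rightarrow> bool" where
  "limit_moments R f A v \<longleftrightarrow> (\<forall>\<epsilon>>0. \<exists>X y. finite X \<and> X \<subseteq> A \<and> (\<forall>m.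
     cmod (\<Sum>x\<in>X. y x * x ^ m) \<le> \<epsilon> * R ^ m \<and> cmod ((\<Sum>x\<in>X. y x * f x * x ^ m) - v m) \<le> \<epsilon> * R ^ m))"

lemma sum_union_point_mass:
  fixes h g :: "'i \<Rightarrow> 'a::comm_ring_1"
  assumes "finite W" "a \<notin> W"
  shows "(\<Sum>x\<in>W \<union> (if \<beta> = 0 then {} else {a}). (if x = a then - \<beta> else h x) * g x) =
    (\<Sum>x\<in>W. h x * g x) - \<beta> * g a"
proof -
  have "(\<Sum>x\<in>W. (if x = a then - \<beta> else h x) * g x) = (\<Sum>x\<in>W. h x * g x)"
    using assms(2) by (intro sum.cong) auto
  then show ?thesis using assms by (cases "\<beta> = 0") simp_all
qed

lemma limit_moments_pole_jump_functional:
  assumes hol: "S holomorphic_on disc" "B holomorphic_on disc"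
    and \<Omega>: "infinite \<Omega>" "\<Omega> \<subseteq> cball 0 \<rho>" "\<rho> < R" "R < 1" and f: "\<And>w. w \<in> \<Omega> \<Longrightarrow> B w * f w = S w"
    and a: "cmod a < R" "\<And>j. j < i \<Longrightarrow> fps_nth (fps_expansion B a) j = 0"
    and A: "\<Omega> \<subseteq> A" "fps_nth (fps_expansion B a) i \<noteq> 0 \<Longrightarrow> a \<in> A"
  shows "limit_moments R f A (\<lambda>m. pole_jump_functional S B f (a, i) (\<lambda>z. z ^ m))"
  unfolding limit_moments_def
proof (intro allI impI)
  fix \<epsilon> :: real assume "\<epsilon> > 0"
  define \<beta> where "\<beta> = fps_nth (fps_expansion B a) i"
  have "cball 0 R \<subseteq> disc" using \<Omega>(4) by (auto simp: disc_def)
  then have "F holomorphic_on cball 0 R" if "F \<in> {S, B}" for F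
    using that hol holomorphic_on_subset by blast
  then obtain W d where W: "finite W" "W \<subseteq> \<Omega> - {a}" and approx: "\<forall>F\<in>{S, B}. \<forall>m.
      cmod (fps_nth (fps_expansion (\<lambda>z. z ^ m * F z) a) i - (\<Sum>w\<in>W. d w * (w ^ m * F w))) \<le> \<epsilon> * R ^ m"
    using taylor_coefficient_moments_approximable[OF \<Omega>(1-3) a(1) \<open>\<epsilon> > 0\<close>, of "{a}" "{S, B}" i] by blast
  define X where "X = W \<union> (if \<beta> = 0 then {} else {a})"
  define y where "y = (\<lambda>x. if x = a then - \<beta> else d x * B x)"
  have "a \<notin> W" using W(2) by blast
  have sum_X: "(\<Sum>x\<in>X. y x * g x) = (\<Sum>w\<in>W. d w * (B w * g w)) - \<beta> * g a" for g
    unfolding X_def y_def sum_union_point_mass[OF W(1) \<open>a \<notin> W\<close>] by (simp only: mult.assoc)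
  have "cmod (\<Sum>x\<in>X. y x * x ^ m) \<le> \<epsilon> * R ^ m" for m
  proof -
    have "B analytic_on {a}"
      using holomorphic_on_imp_analytic_at[OF hol(2)] a(1) \<Omega>(4) by (simp add: disc_def)
    then have "fps_nth (fps_expansion (\<lambda>z. z ^ m * B z) a) i = a ^ m * \<beta>"
      unfolding \<beta>_def using a(2) by (intro fps_nth_fps_expansion_mult_vanishing analytic_intros)
    then show ?thesis
      using bspec[OF approx, of B, rule_format, of m] unfolding sum_X
      by (simp add: norm_minus_commute mult_ac)
  qed
  moreover have "cmod ((\<Sum>x\<in>X. y x * f x * x ^ m) - pole_jump_functional S B f (a, i) (\<lambda>z. z ^ m)) \<le> \<epsilon> * R ^ m"
    for m
  proof -
    have "(\<Sum>w\<in>W. d w * (B w * (f w * w ^ m))) = (\<Sum>w\<in>W. d w * (w ^ m * S w))"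
      using W(2) f by (intro sum.cong) (auto simp: mult_ac)
    then have "(\<Sum>x\<in>X. y x * f x * x ^ m) = (\<Sum>w\<in>W. d w * (w ^ m * S w)) - \<beta> * f a * a ^ m"
      using sum_X[of "\<lambda>x. f x * x ^ m"] by (simp add: mult.assoc)
    then show ?thesis
      using bspec[OF approx, of S, rule_format, of m]
      by (simp add: pole_jump_functional_def \<beta>_def norm_minus_commute)
  qed
  moreover have "finite X" "X \<subseteq> A" using W A by (auto simp: X_def \<beta>_def)
  ultimately show "\<exists>X y. finite X \<and> X \<subseteq> A \<and> (\<forall>m. cmod (\<Sum>x\<in>X. y x * x ^ m) \<le> \<epsilon> * R ^ m \<and>
      cmod ((\<Sum>x\<in>X. y x * f x * x ^ m) - pole_jump_functional S B f (a, i) (\<lambda>z. z ^ m)) \<le> \<epsilon> * R ^ m)"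
    by blast
qed

lemma limit_moments_common_support:
  assumes "finite I" and v: "\<And>\<iota>. \<iota> \<in> I \<Longrightarrow> limit_moments R f A (v \<iota>)" and "\<epsilon> > 0" "x\<^sub>0 \<in> A"
  obtains X Y where "finite X" "X \<subseteq> A" "x\<^sub>0 \<in> X"
    "\<forall>\<iota>\<in>I. \<forall>m. cmod (\<Sum>x\<in>X. Y \<iota> x * x ^ m) \<le> \<epsilon> * R ^ m"
    "\<forall>\<iota>\<in>I. \<forall>m. cmod ((\<Sum>x\<in>X. Y \<iota> x * f x * x ^ m) - v \<iota> m) \<le> \<epsilon> * R ^ m"
proof -
  have "\<forall>\<iota>\<in>I. \<exists>X y. finite X \<and> X \<subseteq> A \<and> (\<forall>m. cmod (\<Sum>x\<in>X. y x * x ^ m) \<le> \<epsilon> * R ^ m \<and>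
      cmod ((\<Sum>x\<in>X. y x * f x * x ^ m) - v \<iota> m) \<le> \<epsilon> * R ^ m)"
    using v \<open>\<epsilon> > 0\<close> by (simp add: limit_moments_def)
  from bchoice[OF this] obtain X' where "\<forall>\<iota>\<in>I. \<exists>y. finite (X' \<iota>) \<and> X' \<iota> \<subseteq> A \<and>
      (\<forall>m. cmod (\<Sum>x\<in>X' \<iota>. y x * x ^ m) \<le> \<epsilon> * R ^ m \<and>
        cmod ((\<Sum>x\<in>X' \<iota>. y x * f x * x ^ m) - v \<iota> m) \<le> \<epsilon> * R ^ m)" ..
  from bchoice[OF this] obtain y where y: "\<forall>\<iota>\<in>I. finite (X' \<iota>) \<and> X' \<iota> \<subseteq> A \<and>
      (\<forall>m. cmod (\<Sum>x\<in>X' \<iota>. y \<iota> x * x ^ m) \<le> \<epsilon> * R ^ m \<and>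
        cmod ((\<Sum>x\<in>X' \<iota>. y \<iota> x * f x * x ^ m) - v \<iota> m) \<le> \<epsilon> * R ^ m)" ..
  define X where "X = insert x\<^sub>0 (\<Union>\<iota>\<in>I. X' \<iota>)"
  define Y where "Y = (\<lambda>\<iota> x. if x \<in> X' \<iota> then y \<iota> x else 0)"
  have X: "finite X" "X \<subseteq> A" using y \<open>finite I\<close> \<open>x\<^sub>0 \<in> A\<close> by (auto simp: X_def)
  have extend: "(\<Sum>x\<in>X. Y \<iota> x * g x) = (\<Sum>x\<in>X' \<iota>. y \<iota> x * g x)" if "\<iota> \<in> I" for \<iota> g
    using X(1) that by (intro sum.mono_neutral_cong_right) (auto simp: X_def Y_def)
  show ?thesis
  proof (rule that[of X Y, OF X])
    show "\<forall>\<iota>\<in>I. \<forall>m. cmod (\<Sum>x\<in>X. Y \<iota> x * x ^ m) \<le> \<epsilon> * R ^ m"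
      and "\<forall>\<iota>\<in>I. \<forall>m. cmod ((\<Sum>x\<in>X. Y \<iota> x * f x * x ^ m) - v \<iota> m) \<le> \<epsilon> * R ^ m"
      using y extend by (simp_all add: mult.assoc)
  qed (simp add: X_def)
qed

lemma dual_polynomials_imp_bounded_below:
  fixes v :: "'i \<Rightarrow> nat \<Rightarrow> complex"
  assumes "finite I" and dual: "\<And>\<iota>. \<iota> \<in> I \<Longrightarrow> \<exists>p :: complex poly. \<forall>\<iota>'\<in>I.
      (\<Sum>m\<le>degree p. coeff p m * v \<iota>' m) = (if \<iota>' = \<iota> then 1 else 0)"
  obtains K where "K > 0" "\<And>t. \<exists>m. (\<Sum>\<iota>\<in>I. cmod (t \<iota>)) \<le> K * cmod (\<Sum>\<iota>\<in>I. t \<iota> * v \<iota> m)"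
proof -
  from dual obtain p :: "'i \<Rightarrow> complex poly" where p: "\<And>\<iota> \<iota>'. \<iota> \<in> I \<Longrightarrow> \<iota>' \<in> I \<Longrightarrow>
      (\<Sum>m\<le>degree (p \<iota>). coeff (p \<iota>) m * v \<iota>' m) = (if \<iota>' = \<iota> then 1 else 0)" by metis
  define K where "K = 1 + (\<Sum>\<iota>\<in>I. \<Sum>m\<le>degree (p \<iota>). cmod (coeff (p \<iota>) m))"
  have "K > 0" unfolding K_def by (intro add_pos_nonneg sum_nonneg) auto
  have "\<exists>m. (\<Sum>\<iota>\<in>I. cmod (t \<iota>)) \<le> K * cmod (\<Sum>\<iota>\<in>I. t \<iota> * v \<iota> m)" for t
  proof (rule ccontr)
    define w where "w = (\<lambda>m. \<Sum>\<iota>\<in>I. t \<iota> * v \<iota> m)"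
    define s where "s = (\<Sum>\<iota>\<in>I. cmod (t \<iota>)) / K"
    assume "\<not> ?thesis"
    then have w_less: "cmod (w m) < s" for m
      using \<open>K > 0\<close> by (simp add: w_def s_def not_le pos_less_divide_eq mult.commute)
    then have "s > 0" by (meson norm_ge_zero le_less_trans)
    have "t \<iota> = (\<Sum>m\<le>degree (p \<iota>). coeff (p \<iota>) m * w m)" if "\<iota> \<in> I" for \<iota>
    proof -
      have "(\<Sum>m\<le>degree (p \<iota>). coeff (p \<iota>) m * w m) =
          (\<Sum>\<iota>'\<in>I. t \<iota>' * (\<Sum>m\<le>degree (p \<iota>). coeff (p \<iota>) m * v \<iota>' m))"
        using sum_lincomb_mult[of t v I "coeff (p \<iota>)"] by (simp add: w_def mult.commute)
      also have "\<dots> = (\<Sum>\<iota>'\<in>I. if \<iota>' = \<iota> then t \<iota>' else 0)" using p[OF that] by (intro sum.cong) auto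
      finally show ?thesis using that \<open>finite I\<close> by simp
    qed
    moreover have "cmod (\<Sum>m\<le>degree (p \<iota>). coeff (p \<iota>) m * w m) \<le> (\<Sum>m\<le>degree (p \<iota>). cmod (coeff (p \<iota>) m)) * s" for \<iota>
      unfolding sum_distrib_right using w_less
      by (intro sum_norm_le) (simp add: norm_mult mult_left_mono less_imp_le)
    ultimately have "cmod (t \<iota>) \<le> (\<Sum>m\<le>degree (p \<iota>). cmod (coeff (p \<iota>) m)) * s" if "\<iota> \<in> I" for \<iota>
      using that by simp
    then have "(\<Sum>\<iota>\<in>I. cmod (t \<iota>)) \<le> (K - 1) * s"
      unfolding K_def by (simp add: sum_distrib_right sum_mono)
    moreover have "K * s = (\<Sum>\<iota>\<in>I. cmod (t \<iota>))" using \<open>K > 0\<close> by (simp add: s_def)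
    ultimately show False using \<open>s > 0\<close> by (simp add: algebra_simps)
  qed
  then show ?thesis using that \<open>K > 0\<close> by blast
qed

lemma pick_form_moment_sums:
  assumes "X \<subseteq> disc"
  shows "(\<lambda>m. (cmod (\<Sum>x\<in>X. c x * x ^ m))\<^sup>2 - (cmod (\<Sum>x\<in>X. c x * f x * x ^ m))\<^sup>2) sums Re (pick_form f X c)"
proof -
  have "(\<lambda>m. \<Sum>x\<in>X. \<Sum>y\<in>X. c x * cnj (c y) * (1 - f x * cnj (f y)) * (x * cnj y) ^ m) sums
      (\<Sum>x\<in>X. \<Sum>y\<in>X. c x * cnj (c y) * (1 - f x * cnj (f y)) * (1 / (1 - x * cnj y)))"
  proof (intro sums_sum sums_mult geometric_sums)
    fix x y assume "x \<in> X" "y \<in> X"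
    then have "cmod x < 1" "cmod y < 1" using assms by (auto simp: disc_def)
    then show "cmod (x * cnj y) < 1"
      using mult_strict_mono[of "cmod x" 1 "cmod y" 1] by (simp add: norm_mult)
  qed
  from sums_Re[OF this] have "(\<lambda>m. Re (\<Sum>x\<in>X. \<Sum>y\<in>X. c x * cnj (c y) * (1 - f x * cnj (f y)) * (x * cnj y) ^ m))
      sums Re (pick_form f X c)" by (simp add: pick_form_def pick_kernel_def)
  moreover have "Re (\<Sum>x\<in>X. \<Sum>y\<in>X. c x * cnj (c y) * (1 - f x * cnj (f y)) * (x * cnj y) ^ m) =
      (cmod (\<Sum>x\<in>X. c x * x ^ m))\<^sup>2 - (cmod (\<Sum>x\<in>X. c x * f x * x ^ m))\<^sup>2" for m
  proof -
    have "(\<Sum>x\<in>X. \<Sum>y\<in>X. c x * cnj (c y) * (1 - f x * cnj (f y)) * (x * cnj y) ^ m) =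
        (\<Sum>x\<in>X. \<Sum>y\<in>X. (c x * x ^ m) * cnj (c y * y ^ m)) -
        (\<Sum>x\<in>X. \<Sum>y\<in>X. (c x * f x * x ^ m) * cnj (c y * f y * y ^ m))"
      unfolding sum_subtractf[symmetric] by (intro sum.cong refl) (simp add: algebra_simps power_mult_distrib)
    also have "\<dots> = (\<Sum>x\<in>X. c x * x ^ m) * cnj (\<Sum>x\<in>X. c x * x ^ m) -
        (\<Sum>x\<in>X. c x * f x * x ^ m) * cnj (\<Sum>x\<in>X. c x * f x * x ^ m)"
      by (simp only: cnj_sum sum_product)
    also have "\<dots> = of_real ((cmod (\<Sum>x\<in>X. c x * x ^ m))\<^sup>2 - (cmod (\<Sum>x\<in>X. c x * f x * x ^ m))\<^sup>2)"
      by (simp only: complex_norm_square of_real_diff)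
    finally show ?thesis by (simp only: Re_complex_of_real)
  qed
  ultimately show ?thesis by simp
qed

lemma pick_form_negative_of_moments:
  assumes X: "X \<subseteq> disc" and R: "0 \<le> R" "R < 1"
    and U: "\<And>m. cmod (\<Sum>x\<in>X. c x * x ^ m) \<le> e * R ^ m"
    and V: "\<kappa> \<le> cmod (\<Sum>x\<in>X. c x * f x * x ^ n)" and \<kappa>: "e < \<kappa> * sqrt (1 - R\<^sup>2)"
  shows "Re (pick_form f X c) < 0"
proof -
  have "R\<^sup>2 < 1" using R by (simp add: power_less_one_iff)
  have "0 \<le> e" using order_trans[OF norm_ge_zero U[of 0]] by simp
  then have "0 < \<kappa>" using \<kappa> \<open>R\<^sup>2 < 1\<close> by (metis real_sqrt_gt_zero diff_gt_0_iff_gt le_less_trans zero_less_mult_pos2)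
  have "Re (pick_form f X c) \<le> e\<^sup>2 * (1 / (1 - R\<^sup>2)) - \<kappa>\<^sup>2"
  proof (rule sums_le[OF _ pick_form_moment_sums[OF X]])
    show "(\<lambda>m. e\<^sup>2 * (R\<^sup>2) ^ m - (if m = n then \<kappa>\<^sup>2 else 0)) sums (e\<^sup>2 * (1 / (1 - R\<^sup>2)) - \<kappa>\<^sup>2)"
      using \<open>R\<^sup>2 < 1\<close> by (intro sums_diff sums_mult geometric_sums sums_single) simp
    fix m
    have "(cmod (\<Sum>x\<in>X. c x * x ^ m))\<^sup>2 \<le> (e * R ^ m)\<^sup>2" by (intro power_mono U) auto
    also have "\<dots> = e\<^sup>2 * (R\<^sup>2) ^ m" by (simp add: power_mult_distrib power_mult[symmetric] mult.commute)
    finally have "(cmod (\<Sum>x\<in>X. c x * x ^ m))\<^sup>2 \<le> e\<^sup>2 * (R\<^sup>2) ^ m" .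
    moreover have "(if m = n then \<kappa>\<^sup>2 else 0) \<le> (cmod (\<Sum>x\<in>X. c x * f x * x ^ m))\<^sup>2"
      using power_mono[OF V, of 2] \<open>0 < \<kappa>\<close> by simp
    ultimately show "(cmod (\<Sum>x\<in>X. c x * x ^ m))\<^sup>2 - (cmod (\<Sum>x\<in>X. c x * f x * x ^ m))\<^sup>2
        \<le> e\<^sup>2 * (R\<^sup>2) ^ m - (if m = n then \<kappa>\<^sup>2 else 0)" by (rule diff_mono)
  qed
  also have "e\<^sup>2 < \<kappa>\<^sup>2 * (1 - R\<^sup>2)"
    using power_strict_mono[OF \<kappa> \<open>0 \<le> e\<close>, of 2] \<open>R\<^sup>2 < 1\<close> by (simp add: power_mult_distrib)
  then have "e\<^sup>2 * (1 / (1 - R\<^sup>2)) - \<kappa>\<^sup>2 < 0" using \<open>R\<^sup>2 < 1\<close> by (simp add: pos_divide_less_eq)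
  finally show ?thesis .
qed

lemma pick_form_lincomb_negative:
  fixes Y :: "'i \<Rightarrow> complex \<Rightarrow> complex"
  assumes X: "X \<subseteq> disc" and R: "0 \<le> R" "R < 1" and "K > 0" and \<epsilon>: "\<epsilon> < (1 / K - \<epsilon>) * sqrt (1 - R\<^sup>2)"
    and U: "\<And>\<iota> m. \<iota> \<in> I \<Longrightarrow> cmod (\<Sum>x\<in>X. Y \<iota> x * x ^ m) \<le> \<epsilon> * R ^ m"
    and V: "\<And>\<iota>. \<iota> \<in> I \<Longrightarrow> cmod ((\<Sum>x\<in>X. Y \<iota> x * f x * x ^ n) - v \<iota>) \<le> \<epsilon> * R ^ n"
    and t: "0 < (\<Sum>\<iota>\<in>I. cmod (t \<iota>))" "(\<Sum>\<iota>\<in>I. cmod (t \<iota>)) \<le> K * cmod (\<Sum>\<iota>\<in>I. t \<iota> * v \<iota>)"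
  shows "Re (pick_form f X (\<lambda>x. \<Sum>\<iota>\<in>I. t \<iota> * Y \<iota> x)) < 0"
proof -
  define \<tau> where "\<tau> = (\<Sum>\<iota>\<in>I. cmod (t \<iota>))"
  have "\<tau> > 0" using t(1) by (simp add: \<tau>_def)
  have weighted: "cmod (\<Sum>\<iota>\<in>I. t \<iota> * h \<iota>) \<le> \<epsilon> * \<tau> * R ^ m"
    if "\<And>\<iota>. \<iota> \<in> I \<Longrightarrow> cmod (h \<iota>) \<le> \<epsilon> * R ^ m" for h m
  proof -
    have "cmod (\<Sum>\<iota>\<in>I. t \<iota> * h \<iota>) \<le> (\<Sum>\<iota>\<in>I. cmod (t \<iota>) * (\<epsilon> * R ^ m))"
      using that by (auto simp: norm_mult intro!: sum_norm_le mult_left_mono)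
    also have "\<dots> = \<epsilon> * \<tau> * R ^ m" unfolding \<tau>_def sum_distrib_right[symmetric] by (simp only: mult_ac)
    finally show ?thesis .
  qed
  have "cmod (\<Sum>\<iota>\<in>I. t \<iota> * (\<Sum>x\<in>X. Y \<iota> x * x ^ 0)) \<le> \<epsilon> * \<tau> * R ^ 0" by (intro weighted U)
  from order_trans[OF norm_ge_zero this] have "0 \<le> \<epsilon> * \<tau>" by simp
  define W where "W = (\<Sum>\<iota>\<in>I. t \<iota> * (\<Sum>x\<in>X. Y \<iota> x * (f x * x ^ n)))"
  have "cmod (W - (\<Sum>\<iota>\<in>I. t \<iota> * v \<iota>)) \<le> \<epsilon> * \<tau> * R ^ n"
    unfolding W_def sum_subtractf[symmetric] right_diff_distrib[symmetric]
    using V by (intro weighted) (simp flip: mult.assoc)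
  also have "\<dots> \<le> \<epsilon> * \<tau> * 1" using \<open>0 \<le> \<epsilon> * \<tau>\<close> R by (intro mult_left_mono power_le_one) auto
  finally have "cmod (\<Sum>\<iota>\<in>I. t \<iota> * v \<iota>) - \<epsilon> * \<tau> \<le> cmod W"
    using norm_triangle_ineq3[of "\<Sum>\<iota>\<in>I. t \<iota> * v \<iota>" W] by (simp add: norm_minus_commute)
  moreover have "\<tau> / K \<le> cmod (\<Sum>\<iota>\<in>I. t \<iota> * v \<iota>)"
    using t(2) \<open>K > 0\<close> by (simp add: \<tau>_def pos_divide_le_eq mult.commute)
  ultimately have W: "(1 / K - \<epsilon>) * \<tau> \<le> cmod W" by (simp add: algebra_simps)
  show ?thesis
  proof (rule pick_form_negative_of_moments[OF X R])
    show "cmod (\<Sum>x\<in>X. (\<Sum>\<iota>\<in>I. t \<iota> * Y \<iota> x) * x ^ m) \<le> \<epsilon> * \<tau> * R ^ m" for m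
      unfolding sum_lincomb_mult by (intro weighted U)
    show "(1 / K - \<epsilon>) * \<tau> \<le> cmod (\<Sum>x\<in>X. (\<Sum>\<iota>\<in>I. t \<iota> * Y \<iota> x) * f x * x ^ n)"
      using W unfolding W_def sum_lincomb_mult[symmetric] by (simp add: mult.assoc)
    show "\<epsilon> * \<tau> < (1 / K - \<epsilon>) * \<tau> * sqrt (1 - R\<^sup>2)"
      using mult_strict_right_mono[OF \<epsilon> \<open>\<tau> > 0\<close>] by (simp only: mult_ac)
  qed
qed

lemma card_le_sq_neg_of_limit_moments:
  assumes A: "A \<subseteq> disc" "A \<noteq> {}" and R: "0 \<le> R" "R < 1" and "finite I"
    and v: "\<And>\<iota>. \<iota> \<in> I \<Longrightarrow> limit_moments R f A (v \<iota>)"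
    and dual: "\<And>\<iota>. \<iota> \<in> I \<Longrightarrow> \<exists>p :: complex poly. \<forall>\<iota>'\<in>I.
      (\<Sum>m\<le>degree p. coeff p m * v \<iota>' m) = (if \<iota>' = \<iota> then 1 else 0)"
  obtains zs where "zs \<noteq> []" "distinct zs" "set zs \<subseteq> A" "card I \<le> sq_neg (pick_matrix f zs)"
proof -
  obtain K where K: "K > 0" "\<And>t. \<exists>m. (\<Sum>\<iota>\<in>I. cmod (t \<iota>)) \<le> K * cmod (\<Sum>\<iota>\<in>I. t \<iota> * v \<iota> m)"
    using dual_polynomials_imp_bounded_below[OF \<open>finite I\<close> dual] by metis
  define \<sigma> where "\<sigma> = sqrt (1 - R\<^sup>2)"
  have \<sigma>: "0 < \<sigma>" "\<sigma> \<le> 1" using R by (simp_all add: \<sigma>_def power_less_one_iff)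
  define \<epsilon> where "\<epsilon> = \<sigma> / (3 * K)"
  have "\<epsilon> > 0" using \<sigma> K(1) by (simp add: \<epsilon>_def)
  have "\<epsilon> + \<epsilon> * \<sigma> \<le> \<epsilon> + \<epsilon>" using \<sigma> \<open>\<epsilon> > 0\<close> by simp
  also have "\<dots> < 3 * \<epsilon>" using \<open>\<epsilon> > 0\<close> by simp
  also have "3 * \<epsilon> = 1 / K * \<sigma>" using K(1) by (simp add: \<epsilon>_def)
  finally have \<epsilon>: "\<epsilon> < (1 / K - \<epsilon>) * \<sigma>" by (simp add: algebra_simps)
  obtain x\<^sub>0 where "x\<^sub>0 \<in> A" using A(2) by blast
  obtain X Y where X: "finite X" "X \<subseteq> A" "x\<^sub>0 \<in> X"
    and Y: "\<forall>\<iota>\<in>I. \<forall>m. cmod (\<Sum>x\<in>X. Y \<iota> x * x ^ m) \<le> \<epsilon> * R ^ m"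
      "\<forall>\<iota>\<in>I. \<forall>m. cmod ((\<Sum>x\<in>X. Y \<iota> x * f x * x ^ m) - v \<iota> m) \<le> \<epsilon> * R ^ m"
    by (rule limit_moments_common_support[OF \<open>finite I\<close> v \<open>\<epsilon> > 0\<close> \<open>x\<^sub>0 \<in> A\<close>])
  have negative: "Re (pick_form f X (\<lambda>x. \<Sum>\<iota>\<in>I. t \<iota> * Y \<iota> x)) < 0" if t: "\<exists>\<iota>\<in>I. t \<iota> \<noteq> 0" for t
  proof -
    obtain n where n: "(\<Sum>\<iota>\<in>I. cmod (t \<iota>)) \<le> K * cmod (\<Sum>\<iota>\<in>I. t \<iota> * v \<iota> n)" using K(2) by blast
    have "0 < (\<Sum>\<iota>\<in>I. cmod (t \<iota>))" using t \<open>finite I\<close> by (auto intro: sum_pos2)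
    then show ?thesis
      using n X(2) A(1) Y by (intro pick_form_lincomb_negative[OF _ R K(1) \<epsilon>[unfolded \<sigma>_def]]) auto
  qed
  obtain zs where zs: "set zs = X" "distinct zs" using finite_distinct_list[OF X(1)] by blast
  have "card I \<le> sq_neg (pick_matrix f zs)"
    using negative zs by (intro card_le_sq_neg_pick_matrix[OF zs(2) \<open>finite I\<close>, where X = Y]) simp
  moreover have "zs \<noteq> []" using zs(1) X(3) by auto
  ultimately show ?thesis using that zs X(2) by blast
qed

lemma finite_subset_disc_radius:
  assumes "finite P" "P \<subseteq> disc" "\<rho> < 1"
  obtains R where "0 < R" "R < 1" "\<rho> < R" "P \<subseteq> ball 0 R"
proof -
  have "Max (insert 0 (insert \<rho> (cmod ` P))) < 1" using assms by (subst Max_less_iff) (auto simp: disc_def)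
  then obtain R where "Max (insert 0 (insert \<rho> (cmod ` P))) < R" "R < 1" using dense by blast
  then show ?thesis using assms(1) by (intro that[of R]) auto
qed

lemma sq_neg_pick_matrix_poles_jumps_ge:
  fixes P A :: "complex set" and N :: "complex \<Rightarrow> nat"
  assumes hol: "S holomorphic_on disc" "B holomorphic_on disc" and A: "A \<subseteq> disc"
    and \<Omega>: "infinite \<Omega>" "\<Omega> \<subseteq> cball 0 \<rho>" "\<rho> < 1" "\<Omega> \<subseteq> A" and f: "\<And>w. w \<in> \<Omega> \<Longrightarrow> B w * f w = S w"
    and P: "finite P" "P \<subseteq> disc" and not_quotient: "\<And>a. a \<in> P \<Longrightarrow> S a \<noteq> B a * f a"
    and order: "\<And>a i. a \<in> P \<Longrightarrow> i < N a \<Longrightarrow> int i \<le> zorder B a"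
    and jump: "\<And>a i. a \<in> P \<Longrightarrow> i < N a \<Longrightarrow> int i = zorder B a \<Longrightarrow> a \<in> A"
  obtains zs where "zs \<noteq> []" "distinct zs" "set zs \<subseteq> A" "(\<Sum>a\<in>P. N a) \<le> sq_neg (pick_matrix f zs)"
proof -
  obtain R where R: "0 < R" "R < 1" "\<rho> < R" "P \<subseteq> ball 0 R"
    by (rule finite_subset_disc_radius[OF P \<Omega>(3)])
  have analytic: "S analytic_on {a}" "B analytic_on {a}" if "a \<in> P" for a
    using hol P(2) that by (auto simp: analytic_at disc_def)
  have vanishing: "fps_nth (fps_expansion B a) j = 0" if "a \<in> P" "int j < zorder B a" for a j
    using fps_nth_fps_expansion_less_zorder analytic(2) that by blast
  define I where "I = Sigma P (\<lambda>a. {..<N a})"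
  define v where "v = (\<lambda>\<iota> m. pole_jump_functional S B f \<iota> (\<lambda>z. z ^ m))"
  have "finite I" using P(1) by (simp add: I_def)
  have moments: "limit_moments R f A (v \<iota>)" if "\<iota> \<in> I" for \<iota>
  proof -
    obtain a i where \<iota>: "\<iota> = (a, i)" "a \<in> P" "i < N a" using \<open>\<iota> \<in> I\<close> by (cases \<iota>) (auto simp: I_def)
    have "cmod a < R" using R(4) \<iota>(2) by auto
    show ?thesis
      unfolding v_def \<iota>(1)
    proof (rule limit_moments_pole_jump_functional[OF hol \<Omega>(1,2) R(3,2) f \<open>cmod a < R\<close> _ \<Omega>(4)])
      show "fps_nth (fps_expansion B a) j = 0" if "j < i" for j
        using vanishing order[OF \<iota>(2,3)] \<iota>(2) that by simp
      show "a \<in> A" if "fps_nth (fps_expansion B a) i \<noteq> 0"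
        using vanishing[OF \<iota>(2), of i] order[OF \<iota>(2,3)] jump[OF \<iota>(2,3)] that by fastforce
    qed
  qed
  have "B a = 0" if "a \<in> P" "1 < N a" for a
    using vanishing[of a 0] order[OF that] that(1) by (simp add: fps_expansion_def)
  then have dual: "\<exists>p :: complex poly. \<forall>\<iota>'\<in>I.
      (\<Sum>m\<le>degree p. coeff p m * v \<iota>' m) = (if \<iota>' = \<iota> then 1 else 0)" if "\<iota> \<in> I" for \<iota>
    using that unfolding I_def v_def
    by (intro pole_jump_moments_dual_polynomial P(1) analytic(1) not_quotient)
  have "A \<noteq> {}" using \<Omega>(1,4) by auto
  from card_le_sq_neg_of_limit_moments[OF A this less_imp_le[OF R(1)] R(2) \<open>finite I\<close> moments dual]
  obtain zs where "zs \<noteq> []" "distinct zs" "set zs \<subseteq> A" "card I \<le> sq_neg (pick_matrix f zs)" by metis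
  moreover have "card I = (\<Sum>a\<in>P. N a)" using P(1) by (simp add: I_def)
  ultimately show ?thesis using that by simp
qed

section \<open>Standard functions\<close>

lemma blaschke_zorder:
  assumes "blaschke B" "a \<in> disc"
  shows "0 \<le> zorder B a" and "a \<notin> zero_set B \<Longrightarrow> zorder B a = 0"
proof -
  have nonzero: "zorder B a = 0" if "a \<notin> zero_set B"
    using holomorphic_on_imp_analytic_at[OF blaschke_holomorphic[OF assms(1)]] assms(2) that
    by (intro zorder_eq_0I) (auto simp: disc_def zero_set_def)
  then show "a \<notin> zero_set B \<Longrightarrow> zorder B a = 0" .
  obtain \<kappa> where \<kappa>: "finite (zero_set B)" "cmod \<kappa> = 1"
    "\<And>z. z \<in> disc \<Longrightarrow> B z = \<kappa> * moebius_product (zero_set B) (\<lambda>a. nat (zorder B a)) z"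
    using blaschke_moebius_factorization[OF assms(1)] by metis
  have "\<kappa> \<noteq> 0" using \<kappa>(2) by auto
  then have "zorder B a = int (nat (zorder B a))" if "a \<in> zero_set B"
    using zorder_moebius_product[OF \<kappa>(1) _ that _ \<kappa>(3)] by (auto simp: zero_set_def)
  then show "0 \<le> zorder B a" using nonzero by fastforce
qed

lemma standard_function_quotient:
  assumes "standard_function g S B Zs \<gamma> W" "z \<in> disc - W" "z \<notin> Zs"
  shows "B z \<noteq> 0" "g z = S z / B z"
proof -
  have "zero_set B \<subseteq> W \<union> Zs" "g z = (if z \<in> Zs then \<gamma> z else S z / B z)"
    using assms(1,2) unfolding standard_function_def by blast+
  then show "B z \<noteq> 0" "g z = S z / B z" using assms(2,3) by (auto simp: zero_set_def)
qed

lemma standard_function_not_quotient: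
  assumes g: "standard_function g S B Zs \<gamma> W" and z: "z \<in> disc" "z \<in> zero_set B \<or> z \<in> Zs"
  shows "S z \<noteq> B z * g z"
proof (cases "z \<in> zero_set B")
  case True
  moreover have "zero_set B \<inter> zero_set S = {}" using g unfolding standard_function_def by blast
  ultimately show ?thesis using z(1) by (auto simp: zero_set_def)
next
  case False
  with g z have "S z / B z \<noteq> \<gamma> z" "z \<in> disc - W" unfolding standard_function_def by blast+
  moreover from this have "g z = \<gamma> z" using g z(2) False unfolding standard_function_def by auto
  ultimately show ?thesis using False z(1) by (auto simp: zero_set_def)
qed

lemma sq_neg_standard_function_le:
  assumes g: "standard_function g S B Zs \<gamma> W" and zs: "distinct zs" "set zs \<subseteq> disc - W"
  shows "sq_neg (pick_matrix g zs) \<le> blaschke_degree B + card (set zs \<inter> Zs)"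
proof (rule sq_neg_pick_matrix_quotient_le[OF zs(1)])
  show "schur_function S" "pick_kernel_rank_le B (blaschke_degree B)"
    using g pick_kernel_rank_le_blaschke unfolding standard_function_def by blast+
  show "B z \<noteq> 0 \<and> g z = S z / B z" if "z \<in> set zs - Zs" for z
    using standard_function_quotient[OF g, of z] zs(2) that by blast
qed (use zs(2) in blast)

lemma open_subset_disc_infinite_cball:
  assumes "open \<Omega>" "\<Omega> \<noteq> {}" "\<Omega> \<subseteq> disc"
  obtains \<rho> where "\<rho> < 1" "infinite (\<Omega> \<inter> cball 0 \<rho>)"
proof -
  obtain w where "w \<in> \<Omega>" using assms(2) by blast
  then have "cmod w < 1" using assms(3) by (auto simp: disc_def)
  then obtain \<rho> where \<rho>: "cmod w < \<rho>" "\<rho> < 1" using dense by blast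
  have "open (\<Omega> \<inter> ball 0 \<rho>)" "\<Omega> \<inter> ball 0 \<rho> \<noteq> {}" using assms(1) \<open>w \<in> \<Omega>\<close> \<rho>(1) by auto
  then have "infinite (\<Omega> \<inter> ball 0 \<rho>)" using finite_imp_not_open by blast
  moreover have "\<Omega> \<inter> ball 0 \<rho> \<subseteq> \<Omega> \<inter> cball 0 \<rho>" by auto
  ultimately show ?thesis using that \<rho>(2) finite_subset by blast
qed

lemma sq_neg_standard_function_ge:
  assumes g: "standard_function g S B Zs \<gamma> W" and \<Omega>: "open \<Omega>" "\<Omega> \<noteq> {}" "\<Omega> \<subseteq> disc - W"
  obtains zs where "zs \<noteq> []" "distinct zs" "set zs \<subseteq> \<Omega>"
    "blaschke_degree B + card (Zs \<inter> \<Omega>) \<le> sq_neg (pick_matrix g zs)"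
proof -
  have "finite Zs" "schur_function S" and B: "blaschke B" using g unfolding standard_function_def by blast+
  define P where "P = zero_set B \<union> (Zs \<inter> \<Omega>)"
  define N where "N = (\<lambda>a. nat (zorder B a) + (if a \<in> Zs \<inter> \<Omega> then 1 else 0))"
  have "finite (zero_set B)" using blaschke_moebius_factorization[OF B] by metis
  then have P: "finite P" "P \<subseteq> disc" using \<open>finite Zs\<close> \<Omega>(3) by (auto simp: P_def zero_set_def)
  have "open (\<Omega> - Zs)" using \<Omega>(1) \<open>finite Zs\<close> by (intro open_Diff finite_imp_closed)
  moreover have "\<Omega> - Zs \<noteq> {}"
    using \<Omega>(1,2) \<open>finite Zs\<close> finite_imp_not_open finite_subset by (metis Diff_eq_empty_iff)
  ultimately obtain \<rho> where \<rho>: "\<rho> < 1" "infinite ((\<Omega> - Zs) \<inter> cball 0 \<rho>)"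
    using open_subset_disc_infinite_cball[of "\<Omega> - Zs"] \<Omega>(3) by blast
  obtain zs where zs: "zs \<noteq> []" "distinct zs" "set zs \<subseteq> \<Omega>" "(\<Sum>a\<in>P. N a) \<le> sq_neg (pick_matrix g zs)"
  proof (rule sq_neg_pick_matrix_poles_jumps_ge[OF _ blaschke_holomorphic[OF B] _ \<rho>(2) _ \<rho>(1) _ _ P])
    show "S holomorphic_on disc" using \<open>schur_function S\<close> by (simp add: schur_function_def)
    show "B w * g w = S w" if "w \<in> (\<Omega> - Zs) \<inter> cball 0 \<rho>" for w
      using standard_function_quotient[OF g, of w] \<Omega>(3) that by auto
    show "S a \<noteq> B a * g a" if "a \<in> P" for a
      using standard_function_not_quotient[OF g] P(2) that by (auto simp: P_def)
    show "int i \<le> zorder B a" if "a \<in> P" "i < N a" for a i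
      using that blaschke_zorder(1)[OF B, of a] P(2) by (auto simp: N_def split: if_splits)
    show "a \<in> \<Omega>" if "a \<in> P" "i < N a" "int i = zorder B a" for a i
      using that by (auto simp: N_def split: if_splits)
  qed (use \<Omega>(3) in auto)
  have "(\<Sum>a\<in>P. N a) = (\<Sum>a\<in>P. nat (zorder B a)) + card (P \<inter> (Zs \<inter> \<Omega>))"
    unfolding N_def sum.distrib sum.inter_restrict[OF P(1), symmetric] by simp
  also have "P \<inter> (Zs \<inter> \<Omega>) = Zs \<inter> \<Omega>" by (auto simp: P_def)
  also have "(\<Sum>a\<in>P. nat (zorder B a)) = blaschke_degree B"
    unfolding blaschke_degree_def using P blaschke_zorder(2)[OF B]
    by (intro sum.mono_neutral_right) (auto simp: P_def)
  finally show ?thesis using that zs by simp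
qed

lemma pick_matrix_cong:
  assumes "\<And>z. z \<in> set zs \<Longrightarrow> f z = g z"
  shows "pick_matrix f zs = pick_matrix g zs"
  unfolding pick_matrix_def using assms by (intro cong_mat) auto

lemma k_n_eqI:
  assumes "length zs = n" "distinct zs" "set zs \<subseteq> \<Omega>" "k \<le> sq_neg (pick_matrix f zs)"
    and upper: "\<And>ws. distinct ws \<Longrightarrow> set ws \<subseteq> \<Omega> \<Longrightarrow> sq_neg (pick_matrix f ws) \<le> k"
  shows "k_n n f \<Omega> = k"
proof -
  define Q where "Q = {sq_neg (pick_matrix f ws) | ws. length ws = n \<and> distinct ws \<and> set ws \<subseteq> \<Omega>}"
  have "\<forall>j\<in>Q. j \<le> k" using upper by (auto simp: Q_def)
  moreover have "k \<in> Q" using assms by (auto simp: Q_def intro: antisym)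
  moreover have "finite Q" using \<open>\<forall>j\<in>Q. j \<le> k\<close> by (auto simp: finite_nat_set_iff_bounded_le)
  ultimately show ?thesis unfolding k_n_def Q_def[symmetric] by (intro Max_eqI) auto
qed

theorem mainTheorem5:
  fixes f g S B :: "complex \<Rightarrow> complex" and \<gamma> :: "complex \<Rightarrow> complex"
    and L Zs W \<Omega> :: "complex set" and \<kappa> :: nat
  assumes "discrete_in_disc L"
    and "in_S_kappa \<kappa> L f"
    and "standard_function g S B Zs \<gamma> W"
    and "W \<subseteq> L"
    and "\<forall>z\<in>disc - L. g z = f z"
    and "Zs \<subseteq> disc - L"
    and "open \<Omega>" and "\<Omega> \<noteq> {}" and "\<Omega> \<subseteq> disc - L"
  shows "\<exists>n>0. k_n n f \<Omega> = blaschke_degree B + card (Zs \<inter> \<Omega>)"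
proof -
  have pick: "pick_matrix f ws = pick_matrix g ws" if "set ws \<subseteq> \<Omega>" for ws
    using assms(5,9) that by (intro pick_matrix_cong) auto
  have \<Omega>: "\<Omega> \<subseteq> disc - W" using assms(4,9) by blast
  obtain zs where zs: "zs \<noteq> []" "distinct zs" "set zs \<subseteq> \<Omega>"
    "blaschke_degree B + card (Zs \<inter> \<Omega>) \<le> sq_neg (pick_matrix g zs)"
    using sq_neg_standard_function_ge[OF assms(3,7,8) \<Omega>] .
  have "sq_neg (pick_matrix f ws) \<le> blaschke_degree B + card (Zs \<inter> \<Omega>)"
    if ws: "distinct ws" "set ws \<subseteq> \<Omega>" for ws
  proof -
    have "sq_neg (pick_matrix g ws) \<le> blaschke_degree B + card (set ws \<inter> Zs)"
      using ws \<Omega> by (intro sq_neg_standard_function_le[OF assms(3)]) auto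
    also have "card (set ws \<inter> Zs) \<le> card (Zs \<inter> \<Omega>)"
      using assms(3) ws(2) by (intro card_mono) (auto simp: standard_function_def)
    finally show ?thesis using pick[OF ws(2)] by simp
  qed
  then have "k_n (length zs) f \<Omega> = blaschke_degree B + card (Zs \<inter> \<Omega>)"
    using zs pick[OF zs(3)] by (intro k_n_eqI[of zs]) auto
  then show ?thesis using zs(1) by blast
qed

end
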